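(* Consider the problem of deletion robust (possibly non-monotone) submodular maximization subject to a matroid constraint of rank $k$ with deletion parameter $d$, in the streaming setting. Fix any constant $\delta \in (0,1)$. Then there exists a constant $G_\delta$ such that for every $\varepsilon \in (0,\delta)$ there exists a streaming algorithm for this problem which is, in expectation, a $(9.435 + G_\delta \cdot \varepsilon)$-approximation and whose summary size and memory are both $O\!\left(k + \frac{d}{\varepsilon^2}\log\frac{k}{\varepsilon}\right)$.
   Context: Setting: $V$ is a finite ground set, $f : 2^V \to \mathbb{R}_{\ge 0}$ is a normalized ($f(\emptyset)=0$) submodular function accessed through a value oracle (not necessarily monotone), and $\mathcal{M} \subseteq 2^V$ is a matroid of rank $k$. Deletion robust streaming model: in Phase I the elements of $V$ arrive one by one in an arbitrary order and the algorithm, given parameter $d$, processes them online and at the end outputs a (possibly random) summary $W \subseteq V$; its memory is the maximum number of elements it stores at any time during Phase I. An adversary, who may know the algorithm but not its random bits, chooses $D \subseteq V$ with $|D| \le d$; in Phase II (offline) the algorithm receives $D$ and its Phase I output and returns $S_D \subseteq W \setminus D$ with $S_D \in \mathcal{M}$. The algorithm is an $\alpha$-approximation if for every $D \subseteq V$ with $|D| \le d$, $\max\{f(R) : R \subseteq V \setminus D, R \in \mathcal{M}\} \le \alpha \cdot \mathbb{E}[f(S_D)]$, the expectation being over the algorithm's randomness. The summary size is $|W|$. *)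

theory Defs
  imports "HOL-Probability.Probability"
begin

definition submodular_on :: "'a set \<Rightarrow> ('a set \<Rightarrow> real) \<Rightarrow> bool" where
  "submodular_on V f \<longleftrightarrow>
     (\<forall>A B. A \<subseteq> V \<and> B \<subseteq> V \<longrightarrow> f (A \<union> B) + f (A \<inter> B) \<le> f A + f B)"

definition matroid :: "'a set \<Rightarrow> 'a set set \<Rightarrow> bool" where
  "matroid V \<M> \<longleftrightarrow> finite V \<and> \<M> \<subseteq> Pow V \<and> {} \<in> \<M> \<and>
     (\<forall>A B. B \<in> \<M> \<and> A \<subseteq> B \<longrightarrow> A \<in> \<M>) \<and>
     (\<forall>A B. A \<in> \<M> \<and> B \<in> \<M> \<and> card A < card B \<longrightarrow> (\<exists>e\<in>B - A. insert e A \<in> \<M>))"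

definition matroid_rank :: "'a set set \<Rightarrow> nat" where
  "matroid_rank \<M> = Max (card ` \<M>)"

definition problem_instance ::
  "nat \<Rightarrow> 'a set \<Rightarrow> ('a set \<Rightarrow> real) \<Rightarrow> 'a set set \<Rightarrow> bool" where
  "problem_instance k V f \<M> \<longleftrightarrow>
     finite V \<and> (\<forall>A\<subseteq>V. 0 \<le> f A) \<and> f {} = 0 \<and> submodular_on V f \<and>
     matroid V \<M> \<and> matroid_rank \<M> = k"

text \<open>
  The state of Phase I: the stored elements, each annotated with finitely many numbers, together
  with finitely many further numbers. Only the stored elements count as memory.
\<close>

type_synonym 'a memory = "('a \<times> real list) list \<times> real list"

definition stored :: "'a memory \<Rightarrow> 'a set" where
  "stored m = fst ` set (fst m)"

definition memory_size :: "'a memory \<Rightarrow> nat" where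
  "memory_size m = length (fst m)"

text \<open>
  Oracle access while the algorithm holds exactly the elements of \<open>X\<close>: it can evaluate \<open>f\<close>, and
  test independence, on subsets of \<open>X\<close> only. An algorithm is a function of these restricted
  oracles, so it learns nothing about \<open>f\<close> and the matroid beyond such queries.
\<close>

definition value_oracle :: "'a set \<Rightarrow> ('a set \<Rightarrow> real) \<Rightarrow> 'a set \<Rightarrow> real" where
  "value_oracle X f = (\<lambda>A. if A \<subseteq> X then f A else 0)"

definition indep_oracle :: "'a set \<Rightarrow> 'a set set \<Rightarrow> 'a set \<Rightarrow> bool" where
  "indep_oracle X \<M> = (\<lambda>A. A \<subseteq> X \<and> A \<in> \<M>)"

text \<open>
  \<open>init\<close> draws the initial numbers (no element is stored yet), \<open>step\<close> processes an arriving
  element, \<open>summarize\<close> produces the summary \<open>W\<close> at the end of the stream, and \<open>solve\<close> is Phase II,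
  taking \<open>W\<close> and \<open>D\<close> in this order.
\<close>

record 'a algorithm =
  init :: "real list pmf"
  step :: "('a set \<Rightarrow> real) \<Rightarrow> ('a set \<Rightarrow> bool) \<Rightarrow> 'a \<Rightarrow> 'a memory \<Rightarrow> 'a memory pmf"
  summarize :: "('a set \<Rightarrow> real) \<Rightarrow> ('a set \<Rightarrow> bool) \<Rightarrow> 'a memory \<Rightarrow> 'a set pmf"
  solve :: "('a set \<Rightarrow> real) \<Rightarrow> ('a set \<Rightarrow> bool) \<Rightarrow> 'a set \<Rightarrow> 'a set \<Rightarrow> 'a set pmf"

text \<open>A discarded element is lost, and the summary consists of stored elements.\<close>

definition streaming_algorithm :: "'a algorithm \<Rightarrow> bool" where
  "streaming_algorithm \<A> \<longleftrightarrow>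
     (\<forall>F I e m. \<forall>m' \<in> set_pmf (step \<A> F I e m). stored m' \<subseteq> insert e (stored m)) \<and>
     (\<forall>F I m. \<forall>W \<in> set_pmf (summarize \<A> F I m). W \<subseteq> stored m)"

fun process ::
  "'a algorithm \<Rightarrow> ('a set \<Rightarrow> real) \<Rightarrow> 'a set set \<Rightarrow> 'a list \<Rightarrow> 'a memory \<Rightarrow> 'a memory pmf" where
  "process \<A> f \<M> [] m = return_pmf m"
| "process \<A> f \<M> (e # es) m =
     bind_pmf
       (step \<A> (value_oracle (insert e (stored m)) f) (indep_oracle (insert e (stored m)) \<M>) e m)
       (process \<A> f \<M> es)"

definition memory_after ::
  "'a algorithm \<Rightarrow> ('a set \<Rightarrow> real) \<Rightarrow> 'a set set \<Rightarrow> 'a list \<Rightarrow> 'a memory pmf" where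
  "memory_after \<A> f \<M> es = bind_pmf (init \<A>) (\<lambda>r. process \<A> f \<M> es ([], r))"

definition phase1 ::
  "'a algorithm \<Rightarrow> ('a set \<Rightarrow> real) \<Rightarrow> 'a set set \<Rightarrow> 'a list \<Rightarrow> 'a set pmf" where
  "phase1 \<A> f \<M> es =
     bind_pmf (memory_after \<A> f \<M> es)
       (\<lambda>m. summarize \<A> (value_oracle (stored m) f) (indep_oracle (stored m) \<M>) m)"

definition phase2 ::
  "'a algorithm \<Rightarrow> ('a set \<Rightarrow> real) \<Rightarrow> 'a set set \<Rightarrow> 'a set \<Rightarrow> 'a set \<Rightarrow> 'a set pmf" where
  "phase2 \<A> f \<M> W D =
     solve \<A> (value_oracle (W \<union> D) f) (indep_oracle (W \<union> D) \<M>) W D"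

definition robust_approximation ::
  "real \<Rightarrow> nat \<Rightarrow> 'a algorithm \<Rightarrow> 'a set \<Rightarrow> ('a set \<Rightarrow> real) \<Rightarrow> 'a set set \<Rightarrow> 'a list \<Rightarrow> bool" where
  "robust_approximation \<alpha> d \<A> V f \<M> es \<longleftrightarrow>
     (\<forall>D. D \<subseteq> V \<and> card D \<le> d \<longrightarrow>
        (\<forall>W \<in> set_pmf (phase1 \<A> f \<M> es). \<forall>S \<in> set_pmf (phase2 \<A> f \<M> W D).
           S \<subseteq> W - D \<and> S \<in> \<M>) \<and>
        Max (f ` {R \<in> \<M>. R \<subseteq> V - D}) \<le>
          \<alpha> * measure_pmf.expectation
                (bind_pmf (phase1 \<A> f \<M> es) (\<lambda>W. phase2 \<A> f \<M> W D)) f)"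

definition summary_size_at_most ::
  "real \<Rightarrow> 'a algorithm \<Rightarrow> ('a set \<Rightarrow> real) \<Rightarrow> 'a set set \<Rightarrow> 'a list \<Rightarrow> bool" where
  "summary_size_at_most b \<A> f \<M> es \<longleftrightarrow>
     (\<forall>W \<in> set_pmf (phase1 \<A> f \<M> es). real (card W) \<le> b)"

definition memory_at_most ::
  "real \<Rightarrow> 'a algorithm \<Rightarrow> ('a set \<Rightarrow> real) \<Rightarrow> 'a set set \<Rightarrow> 'a list \<Rightarrow> bool" where
  "memory_at_most b \<A> f \<M> es \<longleftrightarrow>
     (\<forall>i \<le> length es. \<forall>m \<in> set_pmf (memory_after \<A> f \<M> (take i es)). real (memory_size m) \<le> b)"

end

theory Submission
  imports Defs
begin

text \<open>
  Phase I keeps an independent set \<open>S\<close>, each of whose elements carries the marginal value it had when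
  it was added, and a pool of undecided elements. A pool element is rejected once its marginal value
  is negligible against more than \<open>d\<close> singleton values, or once it is spanned by the elements of \<open>S\<close>
  of at least half its value. As soon as more than \<open>100 * d\<close> pool elements have marginal values within
  a factor of 2, a uniformly random one of them is drawn; with probability 1/3 it enters \<open>S\<close>, evicting
  the cheapest exchangeable element, and otherwise it is discarded. The random draw makes deletions
  cost little, and the coin deals with non-monotonicity. Phase II is an exhaustive search.

  Let \<open>K\<close> be the set of all elements ever added and \<open>Q\<close> an optimal solution. Evictions at least double
  the value, so the elements of \<open>K\<close> have total value at most \<open>2 * w S\<close>; the rejected elements of \<open>Q\<close>
  are paid for by \<open>2 * (w S - w (K \<inter> Q))\<close>, and in expectation those discarded by the coin by
  \<open>2 * w (K \<inter> Q)\<close>. What is left of \<open>Q\<close> is still in the pool and available to Phase II. Hence, up to small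
  terms, \<open>2/3 * f Q \<le> E (f (Q \<union> K)) \<le> (2 + 2 + 1) * E (ALG)\<close>, a factor of 7.5, and the choice of
  constants keeps it below 7.9. So \<open>G = 0\<close> works, with an algorithm that does not depend on \<open>\<epsilon>\<close>.
\<close>

subsection \<open>Matroids\<close>

lemma matroid_subset: "matroid V \<M> \<Longrightarrow> B \<in> \<M> \<Longrightarrow> A \<subseteq> B \<Longrightarrow> A \<in> \<M>"
  unfolding matroid_def by blast

lemma matroid_finite: "matroid V \<M> \<Longrightarrow> A \<in> \<M> \<Longrightarrow> finite A"
  unfolding matroid_def by (auto intro: finite_subset)

lemma matroid_augment:
  assumes "matroid V \<M>" "A \<in> \<M>" "B \<in> \<M>" "card A < card B"
  obtains e where "e \<in> B - A" "insert e A \<in> \<M>"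
  using assms unfolding matroid_def by blast

lemma matroid_extend:
  assumes m: "matroid V \<M>" and B: "B \<in> \<M>"
  shows "A \<in> \<M> \<Longrightarrow> card A \<le> card B \<Longrightarrow>
    \<exists>A'. A \<subseteq> A' \<and> A' \<subseteq> A \<union> B \<and> A' \<in> \<M> \<and> card A' = card B"
proof (induction "card B - card A" arbitrary: A)
  case 0
  then show ?case by (intro exI[of _ A]) auto
next
  case (Suc n)
  then obtain e where e: "e \<in> B - A" "insert e A \<in> \<M>"
    using matroid_augment[OF m _ B, of A] by (metis diff_is_0_eq' nat.simps(3) not_le)
  have c: "card (insert e A) = Suc (card A)"
    using e matroid_finite[OF m Suc.prems(1)] by simp
  have "\<exists>A'. insert e A \<subseteq> A' \<and> A' \<subseteq> insert e A \<union> B \<and> A' \<in> \<M> \<and> card A' = card B"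
    by (rule Suc.hyps(1)) (use Suc.hyps(2) c e in simp_all)
  then show ?case using e by blast
qed

text \<open>Extending \<open>insert u Y\<close> by elements of \<open>S\<close> to an independent
  set of size \<open>card S\<close> leaves out exactly one element of \<open>insert u S\<close>; it
  lies outside \<open>insert u Y\<close>, so it is the \<open>x\<close> wanted.\<close>

lemma matroid_exchange:
  assumes m: "matroid V \<M>" and S: "S \<in> \<M>" and u: "u \<notin> S" "insert u S \<notin> \<M>"
    and Y: "Y \<subseteq> S" "insert u Y \<in> \<M>"
  obtains x where "x \<in> S - Y" "insert u (S - {x}) \<in> \<M>"
proof -
  have fS: "finite S" using matroid_finite[OF m S] .
  have "Y \<subset> S" using u Y by auto
  then have "card Y < card S" using fS by (simp add: psubset_card_mono)
  moreover have "card (insert u Y) = Suc (card Y)"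
    using Y u fS by (metis card_insert_disjoint finite_subset subsetD)
  ultimately obtain A where A: "insert u Y \<subseteq> A" "A \<subseteq> insert u Y \<union> S" "A \<in> \<M>" "card A = card S"
    using matroid_extend[OF m S Y(2)] by auto
  have sub: "A \<subseteq> insert u S" using A Y by auto
  have "card (insert u S - A) = Suc (card S) - card S"
    using sub A(4) fS u by (subst card_Diff_subset) (auto intro: finite_subset)
  then obtain x where x: "insert u S - A = {x}" by (auto simp: card_1_singleton_iff)
  have "x \<in> S - Y" using x A by auto
  moreover have "A = insert u (S - {x})" using x sub A(1) by auto
  ultimately show ?thesis using that A(3) by auto
qed

text \<open>For independent \<open>X\<close> this is membership in the closure of
  \<open>X\<close>.\<close>

definition spanned :: "'a set set \<Rightarrow> 'a \<Rightarrow> 'a set \<Rightarrow> bool" where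
  "spanned \<M> a X \<longleftrightarrow> a \<in> X \<or> insert a X \<notin> \<M>"

lemma spanned_mono:
  assumes "matroid V \<M>" "spanned \<M> a X" "X \<subseteq> Y"
  shows "spanned \<M> a Y"
  using assms matroid_subset[OF assms(1), of "insert a Y" "insert a X"]
  unfolding spanned_def by blast

text \<open>A swap along a circuit keeps the closure. An unspanned \<open>a\<close> would give an
  independent set one larger than \<open>X\<close>; augmenting \<open>X\<close> from it adds
  \<open>a\<close> or \<open>u\<close>, and both are excluded.\<close>

lemma spanned_exchange:
  assumes m: "matroid V \<M>" and X: "X \<in> \<M>" and x: "x \<in> X" and u: "u \<notin> X" "insert u X \<notin> \<M>"
    and X': "insert u (X - {x}) \<in> \<M>" and a: "spanned \<M> a X"
  shows "spanned \<M> a (insert u (X - {x}))"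
proof (rule ccontr)
  assume "\<not> ?thesis"
  then have n: "a \<notin> insert u (X - {x})" "insert a (insert u (X - {x})) \<in> \<M>"
    by (auto simp: spanned_def)
  have "finite X" using matroid_finite[OF m X] .
  then have "card (insert a (insert u (X - {x}))) = Suc (card X)"
    using n x u card_Suc_Diff1[of X x] by (simp del: card_Diff_insert)
  then obtain y where y: "y \<in> insert a (insert u (X - {x})) - X" "insert y X \<in> \<M>"
    using matroid_augment[OF m X n(2)] by auto
  then show False using u a by (auto simp: spanned_def)
qed

text \<open>Match an element \<open>a\<close> of largest \<open>t\<close> with some \<open>s\<close>
  of at least that weight and remove both: levels up to \<open>t a\<close> lose one element on each
  side, and above it the left side is empty.\<close>

lemma sum_le_sum_if_level_counts_le:
  fixes t :: "'a \<Rightarrow> real" and w :: "'b \<Rightarrow> real"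
  assumes "finite T" "finite S" "\<And>s. s \<in> S \<Longrightarrow> 0 \<le> w s"
    and "\<And>\<theta>. card {a \<in> T. \<theta> \<le> t a} \<le> card {s \<in> S. \<theta> \<le> w s}"
  shows "sum t T \<le> sum w S"
  using assms
proof (induction "card T" arbitrary: T S)
  case 0
  then show ?case by (simp add: sum_nonneg)
next
  case (Suc n)
  have "T \<noteq> {}" using Suc.hyps(2) by auto
  then have "Max (t ` T) \<in> t ` T" using Suc.prems(1) by (intro Max_in) auto
  then obtain a where a: "a \<in> T" "t a = Max (t ` T)" by (metis imageE)
  have a_max: "t b \<le> t a" if "b \<in> T" for b
    unfolding a(2) using that Suc.prems(1) by (intro Max_ge) auto
  have "0 < card {b \<in> T. t a \<le> t b}" using a Suc.prems(1) by (auto simp: card_gt_0_iff)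
  also have "\<dots> \<le> card {s \<in> S. t a \<le> w s}" by (rule Suc.prems(4))
  finally obtain s where s: "s \<in> S" "t a \<le> w s" by (auto simp: card_gt_0_iff)
  have "sum t (T - {a}) \<le> sum w (S - {s})"
  proof (rule Suc.hyps(1))
    show "n = card (T - {a})" using Suc.hyps(2) a Suc.prems(1) by simp
    show "card {b \<in> T - {a}. \<theta> \<le> t b} \<le> card {x \<in> S - {s}. \<theta> \<le> w x}" for \<theta>
    proof (cases "\<theta> \<le> t a")
      case True
      have "{b \<in> T - {a}. \<theta> \<le> t b} = {b \<in> T. \<theta> \<le> t b} - {a}"
        "{x \<in> S - {s}. \<theta> \<le> w x} = {x \<in> S. \<theta> \<le> w x} - {s}" by auto
      then show ?thesis using Suc.prems(4)[of \<theta>] True a s by auto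
    next
      case False
      then have "{b \<in> T - {a}. \<theta> \<le> t b} = {}" using a_max by force
      then show ?thesis by (simp only: card.empty)
    qed
  qed (use Suc.prems in auto)
  then show ?case using a s Suc.prems(1,2) by (simp add: sum.remove)
qed

text \<open>At every threshold the elements of \<open>T\<close> above it are spanned by those of
  \<open>S\<close> above it, so the independent set \<open>T\<close> has no more of them. This turns
  span information into a comparison of total weights.\<close>

lemma matroid_spanned_weight:
  fixes t w :: "'a \<Rightarrow> real"
  assumes m: "matroid V \<M>" and T: "T \<in> \<M>" and S: "S \<in> \<M>" and w: "\<And>s. s \<in> S \<Longrightarrow> 0 \<le> w s"
    and sp: "\<And>a. a \<in> T \<Longrightarrow> spanned \<M> a {s \<in> S. t a \<le> w s}"
  shows "sum t T \<le> sum w S"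
proof (rule sum_le_sum_if_level_counts_le)
  show "card {a \<in> T. \<theta> \<le> t a} \<le> card {s \<in> S. \<theta> \<le> w s}" for \<theta>
  proof (rule ccontr)
    assume "\<not> ?thesis"
    then obtain a where a: "a \<in> {a \<in> T. \<theta> \<le> t a} - {s \<in> S. \<theta> \<le> w s}" "insert a {s \<in> S. \<theta> \<le> w s} \<in> \<M>"
      using matroid_augment[OF m matroid_subset[OF m S] matroid_subset[OF m T],
          of "{s \<in> S. \<theta> \<le> w s}" "{a \<in> T. \<theta> \<le> t a}"] by auto
    then have "spanned \<M> a {s \<in> S. \<theta> \<le> w s}"
      by (intro spanned_mono[OF m sp]) auto
    then show False using a by (simp add: spanned_def)
  qed
qed (use matroid_finite[OF m] T S w in auto)

subsection \<open>Submodular functions\<close>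

lemma submodular_onD:
  "submodular_on V f \<Longrightarrow> A \<subseteq> V \<Longrightarrow> B \<subseteq> V \<Longrightarrow> f (A \<union> B) + f (A \<inter> B) \<le> f A + f B"
  unfolding submodular_on_def by blast

definition marg :: "('a set \<Rightarrow> real) \<Rightarrow> 'a set \<Rightarrow> 'a \<Rightarrow> real" where
  "marg f S u = f (insert u S) - f S"

lemma marg_antimono:
  assumes f: "submodular_on V f" and "A \<subseteq> B" "B \<subseteq> V" "u \<in> V" "u \<notin> B"
  shows "marg f B u \<le> marg f A u"
proof -
  have "f (insert u A \<union> B) + f (insert u A \<inter> B) \<le> f (insert u A) + f B"
    using assms by (intro submodular_onD[OF f]) auto
  moreover have "insert u A \<union> B = insert u B" "insert u A \<inter> B = A" using assms by auto
  ultimately show ?thesis by (simp add: marg_def)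
qed

lemma submodular_union_le_sum_marg:
  assumes f: "submodular_on V f" and "finite T" "K \<subseteq> A" "A \<subseteq> V" "T \<subseteq> V" "T \<inter> A = {}"
  shows "f (A \<union> T) \<le> f A + (\<Sum>u\<in>T. marg f K u)"
  using assms(2,5,6)
proof (induction T)
  case (insert u T)
  have "marg f (A \<union> T) u \<le> marg f K u"
    using insert assms by (intro marg_antimono[OF f]) auto
  then show ?case using insert by (simp add: marg_def)
qed simp

text \<open>One step of the sampling lemma, with the minimum over the elements that may still be drawn
  as a potential: it turns \<open>E (f (Q \<union> K)) \<ge> (1 - p) * f Q\<close>, for \<open>K\<close> containing each element with
  probability at most \<open>p\<close>, into a submartingale property.\<close>

definition sampling_potential :: "('a set \<Rightarrow> real) \<Rightarrow> 'a set \<Rightarrow> 'a set \<Rightarrow> 'a set \<Rightarrow> real" where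
  "sampling_potential f Q K U = 2/3 * f (Q \<union> K) + 1/3 * Min ((\<lambda>X. f (Q \<union> K \<union> X)) ` Pow U)"

lemma sampling_potential_step:
  assumes f: "submodular_on V f" and V: "finite V" "Q \<subseteq> V" "K \<subseteq> V" "U \<subseteq> V" "u \<in> U"
  shows "sampling_potential f Q K U \<le> 1/3 * sampling_potential f Q (insert u K) (U - {u})
    + 2/3 * sampling_potential f Q K (U - {u})"
proof -
  let ?m = "\<lambda>K U. Min ((\<lambda>X. f (Q \<union> K \<union> X)) ` Pow U)"
  have fU: "finite U" using V finite_subset by blast
  have attained: "\<exists>X\<subseteq>U - {u}. ?m K' (U - {u}) = f (Q \<union> K' \<union> X)" for K'
  proof -
    have "?m K' (U - {u}) \<in> (\<lambda>X. f (Q \<union> K' \<union> X)) ` Pow (U - {u})"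
      using fU by (intro Min_in) auto
    then show ?thesis by (simp only: image_iff Bex_def Pow_iff)
  qed
  have le: "?m K U \<le> f (Q \<union> K \<union> X)" if "X \<subseteq> U" for X
    using that fU by (intro Min_le) auto
  obtain X1 where X1: "X1 \<subseteq> U - {u}" "?m (insert u K) (U - {u}) = f (Q \<union> insert u K \<union> X1)"
    using attained by blast
  obtain X2 where X2: "X2 \<subseteq> U - {u}" "?m K (U - {u}) = f (Q \<union> K \<union> X2)"
    using attained by blast
  have "?m K U \<le> f (Q \<union> K \<union> insert u X1)" "?m K U \<le> f (Q \<union> K \<union> insert u X2)"
    by (rule le; use X1 X2 V(5) in auto)+
  moreover have "Q \<union> K \<union> insert u X1 = Q \<union> insert u K \<union> X1" by auto
  moreover have "f ((Q \<union> insert u K) \<union> (Q \<union> K \<union> X2)) + f ((Q \<union> insert u K) \<inter> (Q \<union> K \<union> X2))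
      \<le> f (Q \<union> insert u K) + f (Q \<union> K \<union> X2)"
    using V X2 by (intro submodular_onD[OF f]) auto
  moreover have "(Q \<union> insert u K) \<union> (Q \<union> K \<union> X2) = Q \<union> K \<union> insert u X2"
    "(Q \<union> insert u K) \<inter> (Q \<union> K \<union> X2) = Q \<union> K" using X2 by auto
  \<comment> \<open>The bounds on the minimum through \<open>X1\<close> and \<open>X2\<close> enter
    with weights 1/9 and 2/9, submodularity with weight 2/9.\<close>
  ultimately have "2/3 * f (Q \<union> K) + 1/3 * ?m K U \<le> 2/9 * f (Q \<union> insert u K)
      + 1/9 * f (Q \<union> insert u K \<union> X1) + 4/9 * f (Q \<union> K) + 2/9 * f (Q \<union> K \<union> X2)"
    by (simp only:)
  then show ?thesis unfolding sampling_potential_def X1(2) X2(2) by argo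
qed

subsection \<open>The algorithm\<close>

text \<open>A state \<open>(S, w, P, L)\<close> consists of the current solution \<open>S\<close>, the marginal values \<open>w\<close> that its
  elements had when they were added, the pool \<open>P\<close> of undecided elements, and the singleton values
  \<open>L\<close> of all non-loops seen so far.\<close>

type_synonym 'a state = "'a set \<times> ('a \<Rightarrow> real) \<times> 'a set \<times> real list"

definition rejected ::
  "nat \<Rightarrow> nat \<Rightarrow> ('a set \<Rightarrow> real) \<Rightarrow> ('a set \<Rightarrow> bool) \<Rightarrow> 'a set \<Rightarrow> ('a \<Rightarrow> real) \<Rightarrow> real list \<Rightarrow> 'a \<Rightarrow> bool" where
  "rejected k d F I S w L u \<longleftrightarrow>
     marg F S u \<le> 0 \<or>
     d < length (filter (\<lambda>v. 100 * real k * marg F S u \<le> v) L) \<or>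
     \<not> I (insert u {s \<in> S. marg F S u \<le> 2 * w s})"

fun prune :: "nat \<Rightarrow> nat \<Rightarrow> ('a set \<Rightarrow> real) \<Rightarrow> ('a set \<Rightarrow> bool) \<Rightarrow> 'a state \<Rightarrow> 'a state" where
  "prune k d F I (S, w, P, L) = (S, w, {u \<in> P. \<not> rejected k d F I S w L u}, L)"

text \<open>The candidates for eviction are the other elements of the circuit that \<open>u\<close>
  closes in \<open>insert u S\<close>.\<close>

definition exchange :: "('a set \<Rightarrow> bool) \<Rightarrow> ('a \<Rightarrow> real) \<Rightarrow> 'a set \<Rightarrow> 'a \<Rightarrow> 'a set" where
  "exchange I w S u =
     (if I (insert u S) then insert u S
      else insert u (S - {arg_min_on w {x \<in> S. I (insert u (S - {x}))}}))"

text \<open>Weights outside the new solution are reset to 0, so that a state can be recovered from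
  its memory encoding.\<close>

fun accept :: "('a set \<Rightarrow> real) \<Rightarrow> ('a set \<Rightarrow> bool) \<Rightarrow> 'a \<Rightarrow> 'a state \<Rightarrow> 'a state" where
  "accept F I u (S, w, P, L) =
     (exchange I w S u,
      \<lambda>a. if a = u then marg F S u else if a \<in> exchange I w S u then w a else 0, P - {u}, L)"

fun discard :: "'a \<Rightarrow> 'a state \<Rightarrow> 'a state" where
  "discard u (S, w, P, L) = (S, w, P - {u}, L)"

definition is_bucket :: "nat \<Rightarrow> ('a set \<Rightarrow> real) \<Rightarrow> 'a set \<Rightarrow> 'a set \<Rightarrow> 'a set \<Rightarrow> bool" where
  "is_bucket d F S P B \<longleftrightarrow>
     B \<subseteq> P \<and> 100 * d < card B \<and> (\<forall>a\<in>B. \<forall>b\<in>B. marg F S a \<le> 2 * marg F S b)"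

text \<open>The last number is fuel. Each draw removes an element from the pool, so the pool size is
  always enough.\<close>

fun drain ::
  "nat \<Rightarrow> nat \<Rightarrow> ('a set \<Rightarrow> real) \<Rightarrow> ('a set \<Rightarrow> bool) \<Rightarrow> nat \<Rightarrow> 'a state \<Rightarrow> 'a state pmf" where
  "drain k d F I 0 s = return_pmf s"
| "drain k d F I (Suc n) (S, w, P, L) =
     (if \<exists>B. is_bucket d F S P B
      then bind_pmf (pmf_of_set (SOME B. is_bucket d F S P B)) (\<lambda>u.
           bind_pmf (bernoulli_pmf (1/3)) (\<lambda>b.
             drain k d F I n
               (if b then prune k d F I (accept F I u (S, w, P, L)) else discard u (S, w, P, L))))
      else return_pmf (S, w, P, L))"

text \<open>Loops are left out of \<open>L\<close>: only a non-loop is feasible on its own, so only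
  its value can bound the optimum from below.\<close>

fun arrive :: "nat \<Rightarrow> nat \<Rightarrow> ('a set \<Rightarrow> real) \<Rightarrow> ('a set \<Rightarrow> bool) \<Rightarrow> 'a \<Rightarrow> 'a state \<Rightarrow> 'a state" where
  "arrive k d F I e (S, w, P, L) =
     prune k d F I (S, w, insert e P, if I {e} then L @ [F {e}] else L)"

fun state_step ::
  "nat \<Rightarrow> nat \<Rightarrow> ('a set \<Rightarrow> real) \<Rightarrow> ('a set \<Rightarrow> bool) \<Rightarrow> 'a \<Rightarrow> 'a state \<Rightarrow> 'a state pmf" where
  "state_step k d F I e (S, w, P, L) =
     drain k d F I (card (insert e P)) (arrive k d F I e (S, w, P, L))"

section \<open>Encoding of states as memory contents\<close>

definition enum :: "'a set \<Rightarrow> 'a list" where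
  "enum X = (SOME xs. set xs = X \<and> distinct xs)"

text \<open>The length of the annotation tells solution elements, with their weight, from pool
  elements, with the empty list.\<close>

fun encode :: "'a state \<Rightarrow> 'a memory" where
  "encode (S, w, P, L) = (map (\<lambda>a. (a, [w a])) (enum S) @ map (\<lambda>a. (a, [])) (enum P), L)"

definition decode :: "'a memory \<Rightarrow> 'a state" where
  "decode m =
     ({a. \<exists>x. (a, [x]) \<in> set (fst m)},
      \<lambda>a. if \<exists>x. (a, [x]) \<in> set (fst m) then (SOME x. (a, [x]) \<in> set (fst m)) else 0,
      {a. (a, []) \<in> set (fst m)}, snd m)"

definition best :: "('a set \<Rightarrow> real) \<Rightarrow> ('a set \<Rightarrow> bool) \<Rightarrow> 'a set \<Rightarrow> 'a set" where
  "best F I X = arg_max F (\<lambda>R. R \<subseteq> X \<and> I R)"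

definition robust_algorithm :: "nat \<Rightarrow> nat \<Rightarrow> 'a algorithm" where
  "robust_algorithm k d =
     \<lparr>init = return_pmf [],
      step = (\<lambda>F I e m. map_pmf encode (state_step k d F I e (decode m))),
      summarize = (\<lambda>F I m. return_pmf (stored m)),
      solve = (\<lambda>F I W D. return_pmf (best F I (W - D)))\<rparr>"

fun held :: "'a state \<Rightarrow> 'a set" where
  "held (S, w, P, L) = S \<union> P"

fun well_formed :: "'a state \<Rightarrow> bool" where
  "well_formed (S, w, P, L) \<longleftrightarrow> finite S \<and> finite P \<and> (\<forall>a. a \<notin> S \<longrightarrow> w a = 0)"

lemma init_robust_algorithm: "init (robust_algorithm k d) = return_pmf []"
  by (simp add: robust_algorithm_def)

lemma summarize_robust_algorithm: "summarize (robust_algorithm k d) F I m = return_pmf (stored m)"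
  by (simp add: robust_algorithm_def)

lemma enum: "finite X \<Longrightarrow> set (enum X) = X" "finite X \<Longrightarrow> distinct (enum X)"
  using someI_ex[OF finite_distinct_list[of X]] by (auto simp: enum_def)

lemma length_enum: "finite X \<Longrightarrow> length (enum X) = card X"
  using enum distinct_card by metis

lemma stored_encode: "well_formed s \<Longrightarrow> stored (encode s) = held s"
  by (cases s) (auto simp: stored_def enum image_Un image_image)

lemma decode_encode: "well_formed s \<Longrightarrow> decode (encode s) = s"
  by (cases s) (auto simp: decode_def enum image_iff)

lemma well_formed_decode: "well_formed (decode m)"
proof -
  have "{a. \<exists>x. (a, [x]) \<in> set (fst m)} \<subseteq> fst ` set (fst m)" "{a. (a, []) \<in> set (fst m)} \<subseteq> fst ` set (fst m)"
    by force+
  then show ?thesis by (auto simp: decode_def intro: finite_subset)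
qed

lemma held_decode: "held (decode m) \<subseteq> stored m"
  by (force simp: decode_def stored_def)

section \<open>Held elements and the support of the sampling loop\<close>

lemma exchange_subset: "exchange I w S u \<subseteq> insert u S"
  by (auto simp: exchange_def)

lemma exchange_mem: "u \<in> exchange I w S u"
  by (auto simp: exchange_def)

lemma held_prune: "held (prune k d F I s) \<subseteq> held s"
  by (cases s) auto

lemma held_discard: "held (discard u s) \<subseteq> held s"
  by (cases s) auto

lemma held_accept: "u \<in> held s \<Longrightarrow> held (accept F I u s) \<subseteq> held s"
  using exchange_subset by (cases s) fastforce

lemma well_formed_prune: "well_formed s \<Longrightarrow> well_formed (prune k d F I s)"
  by (cases s) auto

lemma well_formed_discard: "well_formed s \<Longrightarrow> well_formed (discard u s)"
  by (cases s) auto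

lemma well_formed_accept: "well_formed s \<Longrightarrow> well_formed (accept F I u s)"
  using exchange_mem[of u I] finite_subset[OF exchange_subset[of I _ _ u]]
  by (cases s) auto

lemma is_bucket_some:
  assumes "\<exists>B. is_bucket d F S P B"
  shows "is_bucket d F S P (SOME B. is_bucket d F S P B)"
  using assms by (rule someI_ex)

lemma is_bucket_finite: "is_bucket d F S P B \<Longrightarrow> finite B \<and> B \<noteq> {}"
  by (auto simp: is_bucket_def intro: card_ge_0_finite)

lemma drain_Suc_no_bucket:
  assumes "\<nexists>B. is_bucket d F S P B"
  shows "drain k d F I (Suc n) (S, w, P, L) = return_pmf (S, w, P, L)"
  unfolding drain.simps using assms by (simp only: if_False)

lemma drain_Suc_bucket:
  assumes "\<exists>B. is_bucket d F S P B"
  obtains B where "is_bucket d F S P B" "B = (SOME B. is_bucket d F S P B)"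
    "set_pmf (pmf_of_set B) = B"
    "drain k d F I (Suc n) (S, w, P, L) =
      bind_pmf (pmf_of_set B) (\<lambda>u. bind_pmf (bernoulli_pmf (1/3)) (\<lambda>b. drain k d F I n
        (if b then prune k d F I (accept F I u (S, w, P, L)) else discard u (S, w, P, L))))"
proof -
  let ?B = "SOME B. is_bucket d F S P B"
  have B: "is_bucket d F S P ?B" by (rule is_bucket_some[OF assms])
  have "drain k d F I (Suc n) (S, w, P, L) =
      bind_pmf (pmf_of_set ?B) (\<lambda>u. bind_pmf (bernoulli_pmf (1/3)) (\<lambda>b. drain k d F I n
        (if b then prune k d F I (accept F I u (S, w, P, L)) else discard u (S, w, P, L))))"
    unfolding drain.simps if_P[OF assms] ..
  moreover have "set_pmf (pmf_of_set ?B) = ?B" using is_bucket_finite[OF B] by simp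
  ultimately show ?thesis by (intro that[OF B refl])
qed

text \<open>An invariant of every accepted or discarded draw holds on the whole support of the loop,
  so later proofs need not unfold the random choices.\<close>

lemma drain_induct [consumes 2, case_names accept discard]:
  assumes "s' \<in> set_pmf (drain k d F I n s)" "Q s"
    and "\<And>u S w P L B. Q (S, w, P, L) \<Longrightarrow> is_bucket d F S P B \<Longrightarrow> u \<in> B \<Longrightarrow>
      Q (prune k d F I (accept F I u (S, w, P, L)))"
    and "\<And>u S w P L B. Q (S, w, P, L) \<Longrightarrow> is_bucket d F S P B \<Longrightarrow> u \<in> B \<Longrightarrow>
      Q (discard u (S, w, P, L))"
  shows "Q s'"
  using assms(1,2)
proof (induction n arbitrary: s)
  case 0
  then show ?case by simp
next
  case (Suc n)
  obtain S w P L where s: "s = (S, w, P, L)" by (cases s)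
  show ?case
  proof (cases "\<exists>B. is_bucket d F S P B")
    case True
    obtain B where B: "is_bucket d F S P B" "set_pmf (pmf_of_set B) = B"
      "drain k d F I (Suc n) s = bind_pmf (pmf_of_set B) (\<lambda>u. bind_pmf (bernoulli_pmf (1/3))
        (\<lambda>b. drain k d F I n (if b then prune k d F I (accept F I u s) else discard u s)))"
      unfolding s by (rule drain_Suc_bucket[OF True])
    obtain u b where u: "u \<in> B" and s': "s' \<in> set_pmf (drain k d F I n
        (if b then prune k d F I (accept F I u s) else discard u s))"
      using Suc.prems(1) unfolding B(3) set_bind_pmf B(2) by blast
    show ?thesis
      by (rule Suc.IH[OF s']) (use assms(3,4)[OF _ B(1) u] Suc.prems(2) s in auto)
  next
    case False
    then show ?thesis using Suc.prems drain_Suc_no_bucket unfolding s by fastforce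
  qed
qed

lemma drain_support:
  assumes "s' \<in> set_pmf (drain k d F I n s)" "well_formed s"
  shows "well_formed s' \<and> held s' \<subseteq> held s"
proof -
  have "well_formed s \<and> held s \<subseteq> held s" using assms(2) by simp
  with assms(1) show ?thesis
  proof (induction rule: drain_induct)
    case (accept u S w P L B)
    then have "u \<in> held (S, w, P, L)" by (auto simp: is_bucket_def)
    then show ?case
      using accept held_prune held_accept well_formed_prune well_formed_accept by (meson subset_trans)
  next
    case (discard u S w P L B)
    then show ?case
      using held_discard well_formed_discard by (meson subset_trans)
  qed
qed

lemma arrive_support:
  assumes "well_formed s"
  shows "well_formed (arrive k d F I e s) \<and> held (arrive k d F I e s) \<subseteq> insert e (held s)"
  using assms by (cases s) auto

lemma state_step_support:
  assumes "s' \<in> set_pmf (state_step k d F I e s)" "well_formed s"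
  shows "well_formed s' \<and> held s' \<subseteq> insert e (held s)"
proof -
  obtain n where "s' \<in> set_pmf (drain k d F I n (arrive k d F I e s))"
    using assms(1) by (cases s) auto
  from drain_support[OF this] arrive_support[OF assms(2)] show ?thesis by blast
qed

lemma streaming_robust_algorithm: "streaming_algorithm (robust_algorithm k d)"
  unfolding streaming_algorithm_def
proof (intro conjI allI ballI)
  fix F I e m m'
  assume "m' \<in> set_pmf (step (robust_algorithm k d) F I e m)"
  then obtain s' where s': "s' \<in> set_pmf (state_step k d F I e (decode m))" "m' = encode s'"
    by (auto simp: robust_algorithm_def)
  from state_step_support[OF s'(1) well_formed_decode]
  have "stored m' \<subseteq> insert e (held (decode m))" by (simp only: s'(2) stored_encode)
  then show "stored m' \<subseteq> insert e (stored m)" using held_decode[of m] by blast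
qed (auto simp: robust_algorithm_def)

lemma finite_drain: "finite (set_pmf (drain k d F I n s))"
proof (induction n arbitrary: s)
  case (Suc n)
  obtain S w P L where s: "s = (S, w, P, L)" by (cases s)
  show ?case
  proof (cases "\<exists>B. is_bucket d F S P B")
    case True
    obtain B where B: "is_bucket d F S P B" "set_pmf (pmf_of_set B) = B"
      "drain k d F I (Suc n) s = bind_pmf (pmf_of_set B) (\<lambda>u. bind_pmf (bernoulli_pmf (1/3))
        (\<lambda>b. drain k d F I n (if b then prune k d F I (accept F I u s) else discard u s)))"
      unfolding s by (rule drain_Suc_bucket[OF True])
    show ?thesis
      unfolding B(3) set_bind_pmf B(2) using Suc is_bucket_finite[OF B(1)] by (intro finite_UN_I) simp_all
  next
    case False
    show ?thesis unfolding s drain_Suc_no_bucket[OF False] by simp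
  qed
qed simp

lemma finite_state_step: "finite (set_pmf (state_step k d F I e s))"
  by (cases s) (simp add: finite_drain)

subsection \<open>Restricted oracles\<close>

text \<open>The oracles are arbitrary functions that are correct on subsets of \<open>X\<close>.
  Each component of the algorithm then equals its counterpart with \<open>f\<close> and
  \<open>\<M>\<close> as long as the elements involved lie in \<open>X\<close>.\<close>

definition agree where
  "agree X F I f \<M> \<longleftrightarrow> (\<forall>A\<subseteq>X. F A = f A \<and> I A = (A \<in> \<M>))"

lemma agree_oracles: "agree X (value_oracle X f) (indep_oracle X \<M>) f \<M>"
  by (auto simp: agree_def value_oracle_def indep_oracle_def)

lemma agree_marg: "agree X F I f \<M> \<Longrightarrow> insert u S \<subseteq> X \<Longrightarrow> marg F S u = marg f S u"
  by (simp add: agree_def marg_def)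

lemma agree_rejected:
  assumes "agree X F I f \<M>" "insert u S \<subseteq> X"
  shows "rejected k d F I S w L u = rejected k d f (\<lambda>A. A \<in> \<M>) S w L u"
proof -
  have "insert u {s \<in> S. marg f S u \<le> 2 * w s} \<subseteq> X" using assms(2) by auto
  then show ?thesis
    using assms(1) unfolding rejected_def agree_marg[OF assms] by (simp add: agree_def)
qed

lemma agree_prune:
  assumes "agree X F I f \<M>" "held s \<subseteq> X"
  shows "prune k d F I s = prune k d f (\<lambda>A. A \<in> \<M>) s"
proof -
  obtain S w P L where s: "s = (S, w, P, L)" by (cases s)
  have "rejected k d F I S w L u = rejected k d f (\<lambda>A. A \<in> \<M>) S w L u" if "u \<in> P" for u
    using assms(2) that s by (intro agree_rejected[OF assms(1)]) auto
  then show ?thesis unfolding s by auto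
qed

lemma agree_exchange:
  assumes "agree X F I f \<M>" "insert u S \<subseteq> X"
  shows "exchange I w S u = exchange (\<lambda>A. A \<in> \<M>) w S u"
proof -
  have "insert u (S - {x}) \<subseteq> X" for x using assms(2) by auto
  then have "I (insert u (S - {x})) = (insert u (S - {x}) \<in> \<M>)" "I (insert u S) = (insert u S \<in> \<M>)" for x
    using assms by (auto simp: agree_def)
  then show ?thesis by (simp add: exchange_def)
qed

lemma agree_accept:
  assumes "agree X F I f \<M>" "insert u (held s) \<subseteq> X"
  shows "accept F I u s = accept f (\<lambda>A. A \<in> \<M>) u s"
proof -
  obtain S w P L where s: "s = (S, w, P, L)" by (cases s)
  have "insert u S \<subseteq> X" using assms(2) s by auto
  then show ?thesis unfolding s accept.simps by (simp only: agree_marg[OF assms(1)] agree_exchange[OF assms(1)])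
qed

lemma agree_is_bucket:
  assumes "agree X F I f \<M>" "S \<union> P \<subseteq> X"
  shows "is_bucket d F S P B = is_bucket d f S P B"
proof (cases "B \<subseteq> P")
  case True
  then have "marg F S a = marg f S a" if "a \<in> B" for a
    using assms that by (intro agree_marg[OF assms(1)]) auto
  then show ?thesis by (simp add: is_bucket_def)
qed (simp add: is_bucket_def)

lemma agree_drain:
  assumes a: "agree X F I f \<M>" and "held s \<subseteq> X"
  shows "drain k d F I n s = drain k d f (\<lambda>A. A \<in> \<M>) n s"
  using assms(2)
proof (induction n arbitrary: s)
  case (Suc n)
  obtain S w P L where s: "s = (S, w, P, L)" by (cases s)
  have X: "S \<union> P \<subseteq> X" using Suc.prems s by simp
  note bucket = agree_is_bucket[OF a X, of d]
  show ?case
  proof (cases "\<exists>B. is_bucket d f S P B")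
    case True
    let ?I = "\<lambda>A. A \<in> \<M>"
    obtain B where B: "is_bucket d f S P B" "B = (SOME B. is_bucket d f S P B)" "set_pmf (pmf_of_set B) = B"
      "drain k d f ?I (Suc n) s = bind_pmf (pmf_of_set B) (\<lambda>u. bind_pmf (bernoulli_pmf (1/3))
        (\<lambda>b. drain k d f ?I n (if b then prune k d f ?I (accept f ?I u s) else discard u s)))"
      unfolding s by (rule drain_Suc_bucket[OF True])
    have True': "\<exists>B. is_bucket d F S P B" using True unfolding bucket .
    obtain B' where B': "B' = (SOME B. is_bucket d F S P B)"
      "drain k d F I (Suc n) s = bind_pmf (pmf_of_set B') (\<lambda>u. bind_pmf (bernoulli_pmf (1/3))
        (\<lambda>b. drain k d F I n (if b then prune k d F I (accept F I u s) else discard u s)))"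
      unfolding s by (rule drain_Suc_bucket[OF True'])
    \<comment> \<open>Both buckets are chosen by \<open>SOME\<close> from the same predicate, hence
      coincide.\<close>
    have "B' = B" unfolding B'(1) B(2) bucket ..
    have "drain k d F I n (if b then prune k d F I (accept F I u s) else discard u s) =
        drain k d f (\<lambda>A. A \<in> \<M>) n (if b then prune k d f (\<lambda>A. A \<in> \<M>) (accept f (\<lambda>A. A \<in> \<M>) u s) else discard u s)"
      if "u \<in> B" for u b
    proof -
      have u: "u \<in> held s" using B(1) that by (auto simp: is_bucket_def s)
      have acc: "accept F I u s = accept f (\<lambda>A. A \<in> \<M>) u s"
        using Suc.prems u by (intro agree_accept[OF a]) auto
      have h: "held (accept f (\<lambda>A. A \<in> \<M>) u s) \<subseteq> X"
        using held_accept[OF u] Suc.prems by (rule subset_trans)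
      have "prune k d F I (accept F I u s) = prune k d f (\<lambda>A. A \<in> \<M>) (accept f (\<lambda>A. A \<in> \<M>) u s)"
        unfolding acc by (rule agree_prune[OF a h])
      moreover have "held (prune k d f (\<lambda>A. A \<in> \<M>) (accept f (\<lambda>A. A \<in> \<M>) u s)) \<subseteq> X" "held (discard u s) \<subseteq> X"
        using held_prune h held_discard Suc.prems by (meson subset_trans)+
      ultimately show ?thesis using Suc.IH by auto
    qed
    then show ?thesis
      unfolding B(4) B'(2) \<open>B' = B\<close> by (intro bind_pmf_cong refl) (simp only: B(3))
  next
    case False
    then show ?thesis unfolding s by (simp only: drain_Suc_no_bucket bucket not_False_eq_True)
  qed
qed simp

lemma agree_arrive:
  assumes "agree X F I f \<M>" "insert e (held s) \<subseteq> X"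
  shows "arrive k d F I e s = arrive k d f (\<lambda>A. A \<in> \<M>) e s"
proof -
  have "I {e} = ({e} \<in> \<M>)" "F {e} = f {e}" using assms by (auto simp: agree_def)
  then show ?thesis using assms agree_prune[OF assms(1)] by (cases s) (simp del: prune.simps)
qed

lemma agree_state_step:
  assumes "agree X F I f \<M>" "insert e (held s) \<subseteq> X" "well_formed s"
  shows "state_step k d F I e s = state_step k d f (\<lambda>A. A \<in> \<M>) e s"
proof -
  have "held (arrive k d f (\<lambda>A. A \<in> \<M>) e s) \<subseteq> X"
    using arrive_support[OF assms(3)] assms(2) by (meson subset_trans)
  then show ?thesis
    using agree_arrive[OF assms(1,2)] agree_drain[OF assms(1)]
    by (cases s) (simp del: arrive.simps)
qed

section \<open>Phase I on decoded states\<close>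

fun run :: "nat \<Rightarrow> nat \<Rightarrow> ('a set \<Rightarrow> real) \<Rightarrow> 'a set set \<Rightarrow> 'a list \<Rightarrow> 'a state \<Rightarrow> 'a state pmf" where
  "run k d f \<M> [] s = return_pmf s"
| "run k d f \<M> (e # es) s = bind_pmf (state_step k d f (\<lambda>A. A \<in> \<M>) e s) (run k d f \<M> es)"

text \<open>Transfers Phase I from memories and restricted oracles to \<open>run\<close>, on which
  the analysis is carried out. The oracles at each step cover the held elements and the arrival, and
  nothing else is queried.\<close>

lemma process_robust_algorithm:
  assumes "well_formed s"
  shows "process (robust_algorithm k d) f \<M> es (encode s) = map_pmf encode (run k d f \<M> es s)"
  using assms
proof (induction es arbitrary: s)
  case (Cons e es)
  let ?X = "insert e (held s)"
  have "process (robust_algorithm k d) f \<M> (e # es) (encode s) =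
      bind_pmf (map_pmf encode (state_step k d (value_oracle ?X f) (indep_oracle ?X \<M>) e s))
        (process (robust_algorithm k d) f \<M> es)"
    using Cons.prems by (simp add: stored_encode robust_algorithm_def decode_encode)
  also have "state_step k d (value_oracle ?X f) (indep_oracle ?X \<M>) e s = state_step k d f (\<lambda>A. A \<in> \<M>) e s"
    by (rule agree_state_step[OF agree_oracles subset_refl Cons.prems])
  also have "bind_pmf (map_pmf encode (state_step k d f (\<lambda>A. A \<in> \<M>) e s))
        (process (robust_algorithm k d) f \<M> es) =
      bind_pmf (state_step k d f (\<lambda>A. A \<in> \<M>) e s) (\<lambda>s'. map_pmf encode (run k d f \<M> es s'))"
    unfolding bind_map_pmf
    using Cons.IH state_step_support[OF _ Cons.prems] by (intro bind_pmf_cong) auto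
  finally show ?case by (simp add: map_bind_pmf)
qed simp

definition initial_state :: "'a state" where
  "initial_state = ({}, \<lambda>_. 0, {}, [])"

lemma memory_after_robust_algorithm:
  "memory_after (robust_algorithm k d) f \<M> es = map_pmf encode (run k d f \<M> es initial_state)"
proof -
  have "enum {} = ([] :: 'a list)" using length_enum[of "{} :: 'a set"] by simp
  then have e: "encode initial_state = (([], []) :: 'a memory)" by (simp add: initial_state_def)
  have "well_formed (initial_state :: 'a state)" by (simp add: initial_state_def)
  then have "process (robust_algorithm k d) f \<M> es ([], []) = map_pmf encode (run k d f \<M> es initial_state)"
    unfolding e[symmetric] by (rule process_robust_algorithm)
  then show ?thesis unfolding memory_after_def init_robust_algorithm bind_return_pmf .
qed

lemma finite_run: "finite (set_pmf (run k d f \<M> es s))"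
proof (induction es arbitrary: s)
  case (Cons e es)
  show ?case unfolding run.simps set_bind_pmf by (intro finite_UN_I finite_state_step Cons)
qed simp

lemma run_well_formed:
  assumes "well_formed s" "s' \<in> set_pmf (run k d f \<M> es s)"
  shows "well_formed s'"
  using assms
proof (induction es arbitrary: s)
  case (Cons e es)
  from Cons.prems(2) obtain s1 where s1: "s1 \<in> set_pmf (state_step k d f (\<lambda>A. A \<in> \<M>) e s)"
    "s' \<in> set_pmf (run k d f \<M> es s1)"
    unfolding run.simps set_bind_pmf by blast
  show ?case by (rule Cons.IH[OF _ s1(2)]) (use state_step_support[OF s1(1) Cons.prems(1)] in simp)
qed simp

lemma phase1_robust_algorithm:
  "phase1 (robust_algorithm k d) f \<M> es = map_pmf held (run k d f \<M> es initial_state)"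
proof -
  have "stored (encode s) = held s" if "s \<in> set_pmf (run k d f \<M> es initial_state)" for s :: "'a state"
    by (rule stored_encode, rule run_well_formed[OF _ that]) (simp add: initial_state_def)
  then show ?thesis
    unfolding phase1_def memory_after_robust_algorithm summarize_robust_algorithm bind_map_pmf
    unfolding map_pmf_def by (intro bind_pmf_cong refl) simp
qed

subsection \<open>Invariants of the solution\<close>

locale robust_instance =
  fixes k d :: nat and V :: "'a set" and f :: "'a set \<Rightarrow> real" and \<M> :: "'a set set"
  assumes problem: "problem_instance k V f \<M>"
begin

abbreviation indep :: "'a set \<Rightarrow> bool" where
  "indep A \<equiv> A \<in> \<M>"

lemma finite_V: "finite V" and nonneg: "A \<subseteq> V \<Longrightarrow> 0 \<le> f A" and f_empty: "f {} = 0"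
  and submodular: "submodular_on V f" and matroid: "matroid V \<M>" and rank: "matroid_rank \<M> = k"
  using problem by (auto simp: problem_instance_def)

lemma finite_indep_sets: "finite \<M>"
  using matroid finite_V by (auto simp: matroid_def intro: finite_subset)

lemma card_indep: "A \<in> \<M> \<Longrightarrow> card A \<le> k"
  using rank finite_indep_sets by (auto simp: matroid_rank_def)

text \<open>\<open>E\<close> is the set of elements seen so far. The bound on \<open>f\<close> is
  required for all subsets of \<open>S\<close> because deletions leave an arbitrary part of it;
  \<open>xs\<close> is distinct so that counting entries of \<open>L\<close> counts
  elements.\<close>

fun sound :: "'a set \<Rightarrow> 'a state \<Rightarrow> bool" where
  "sound E (S, w, P, L) \<longleftrightarrow>
     S \<in> \<M> \<and> S \<subseteq> E \<and> P \<subseteq> E \<and> S \<inter> P = {} \<and> (\<forall>a\<in>S. 0 < w a) \<and> (\<forall>X\<subseteq>S. sum w X \<le> f X) \<and>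
     (\<exists>xs. distinct xs \<and> set xs = {x \<in> E. {x} \<in> \<M>} \<and> L = map (\<lambda>x. f {x}) xs)"

fun pruned :: "'a state \<Rightarrow> bool" where
  "pruned (S, w, P, L) \<longleftrightarrow> (\<forall>u\<in>P. \<not> rejected k d f indep S w L u)"

lemma pruned_prune: "pruned (prune k d f indep s)"
  by (cases s) simp

lemma pruned_discard: "pruned s \<Longrightarrow> pruned (discard u s)"
  by (cases s) simp

lemma sound_prune: "sound E s \<Longrightarrow> sound E (prune k d f indep s)"
  by (cases s) auto

lemma sound_discard: "sound E s \<Longrightarrow> sound E (discard u s)"
  by (cases s) auto

text \<open>Since \<open>u\<close> is not spanned by the elements of at least half its value, some
  cheaper element is removable. Minimality of the evicted \<open>x\<close> gives the dependence in
  the swap case, which later shows that no level set loses span.\<close>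

lemma exchange_cases:
  assumes S: "S \<in> \<M>" "u \<notin> S" "insert u {s \<in> S. marg f S u \<le> 2 * w s} \<in> \<M>"
  obtains (add) "insert u S \<in> \<M>" "exchange indep w S u = insert u S"
  | (swap) x where "x \<in> S" "insert u (S - {x}) \<in> \<M>" "exchange indep w S u = insert u (S - {x})"
    "2 * w x < marg f S u" "insert u {s \<in> S. w x \<le> w s} \<notin> \<M>"
proof (cases "insert u S \<in> \<M>")
  case True
  then show ?thesis using add by (simp add: exchange_def)
next
  case False
  let ?X = "{x \<in> S. insert u (S - {x}) \<in> \<M>}"
  define x where "x = arg_min_on w ?X"
  have "finite ?X" using matroid_finite[OF matroid S(1)] by simp
  moreover have "?X \<noteq> {}"
    using matroid_exchange[OF matroid S(1,2) False _ S(3)] by blast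
  ultimately have x: "x \<in> ?X" and x_min: "\<And>y. y \<in> ?X \<Longrightarrow> w x \<le> w y"
    unfolding x_def using arg_min_if_finite[of ?X w] by (auto simp: not_less)
  \<comment> \<open>If this set were independent, the exchange lemma would yield a removable element
    cheaper than \<open>x\<close>.\<close>
  have dep: "insert u {s \<in> S. w x \<le> w s} \<notin> \<M>"
  proof
    assume "insert u {s \<in> S. w x \<le> w s} \<in> \<M>"
    then obtain y where "y \<in> S - {s \<in> S. w x \<le> w s}" "insert u (S - {y}) \<in> \<M>"
      by (rule matroid_exchange[OF matroid S(1,2) False, rotated]) auto
    then show False using x_min[of y] by auto
  qed
  have "2 * w x < marg f S u"
  proof (rule ccontr)
    assume "\<not> ?thesis"
    then have "insert u {s \<in> S. w x \<le> w s} \<subseteq> insert u {s \<in> S. marg f S u \<le> 2 * w s}" by auto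
    then show False using dep matroid_subset[OF matroid S(3)] by blast
  qed
  moreover have "exchange indep w S u = insert u (S - {x})"
    using False by (simp add: exchange_def x_def)
  ultimately show ?thesis using swap x dep by blast
qed

lemma not_rejectedD:
  assumes "\<not> rejected k d f indep S w L u"
  shows "0 < marg f S u" "insert u {s \<in> S. marg f S u \<le> 2 * w s} \<in> \<M>"
    "length (filter (\<lambda>v. 100 * real k * marg f S u \<le> v) L) \<le> d"
  using assms by (auto simp: rejected_def)

lemma exchange_indep:
  assumes "S \<in> \<M>" "u \<notin> S" "insert u {s \<in> S. marg f S u \<le> 2 * w s} \<in> \<M>"
  shows "exchange indep w S u \<in> \<M>"
  using assms by (rule exchange_cases) simp_all

text \<open>The subset bound survives because \<open>X - {u}\<close> is part of the old
  \<open>S\<close>, so the marginal value of \<open>u\<close> over it is at least the one over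
  \<open>S\<close>.\<close>

lemma sound_accept:
  assumes E: "E \<subseteq> V" and s: "sound E s" "pruned s" and u: "u \<in> held s" "u \<notin> fst s"
  shows "sound E (accept f indep u s)"
proof -
  obtain S w P L where s_eq: "s = (S, w, P, L)" by (cases s)
  let ?T = "exchange indep w S u" and ?a = "marg f S u"
  let ?w = "\<lambda>a. if a = u then ?a else if a \<in> ?T then w a else 0"
  have S: "S \<in> \<M>" "S \<subseteq> E" "P \<subseteq> E" "S \<inter> P = {}" "\<And>a. a \<in> S \<Longrightarrow> 0 < w a"
    "\<And>X. X \<subseteq> S \<Longrightarrow> sum w X \<le> f X" using s(1) s_eq by auto
  have u': "u \<in> P" "u \<notin> S" using u s_eq by auto
  have nr: "\<not> rejected k d f indep S w L u" using s(2) u' s_eq by simp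
  have T: "?T \<in> \<M>" by (rule exchange_indep[OF S(1) u'(2) not_rejectedD(2)[OF nr]])
  have sub: "?T \<subseteq> insert u S" by (rule exchange_subset)
  have "sum ?w X \<le> f X" if X: "X \<subseteq> ?T" for X
  proof -
    have fX: "finite X" using X T matroid_finite[OF matroid] finite_subset by blast
    have "X - {u} \<subseteq> S" using X sub by auto
    have "sum ?w (X - {u}) = sum w (X - {u})" using X by (intro sum.cong) auto
    also have "\<dots> \<le> f (X - {u})" by (rule S(6)[OF \<open>X - {u} \<subseteq> S\<close>])
    finally have le: "sum ?w (X - {u}) \<le> f (X - {u})" .
    show ?thesis
    proof (cases "u \<in> X")
      case True
      have "?a \<le> marg f (X - {u}) u"
        using \<open>X - {u} \<subseteq> S\<close> S(2,3) E u' by (intro marg_antimono[OF submodular]) auto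
      also have "\<dots> = f X - f (X - {u})" using True by (simp add: marg_def insert_absorb)
      finally show ?thesis using le sum.remove[OF fX True, of ?w] by simp
    next
      case False
      then show ?thesis using le by simp
    qed
  qed
  moreover have "0 < ?w a" if "a \<in> ?T" for a
    using that sub S(5) not_rejectedD(1)[OF nr] by auto
  moreover have "?T \<subseteq> E" "P - {u} \<subseteq> E" "?T \<inter> (P - {u}) = {}" using sub S u' by auto
  ultimately show ?thesis using s(1) T unfolding s_eq accept.simps sound.simps by blast
qed

lemma sound_insert:
  assumes s: "sound E (S, w, P, L)" and e: "e \<notin> E"
  shows "sound (insert e E) (S, w, insert e P, if {e} \<in> \<M> then L @ [f {e}] else L)"
proof -
  obtain xs where xs: "distinct xs" "set xs = {x \<in> E. {x} \<in> \<M>}" "L = map (\<lambda>x. f {x}) xs"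
    using s by auto
  let ?xs = "if {e} \<in> \<M> then xs @ [e] else xs"
  have "distinct ?xs" "set ?xs = {x \<in> insert e E. {x} \<in> \<M>}"
    "(if {e} \<in> \<M> then L @ [f {e}] else L) = map (\<lambda>x. f {x}) ?xs" using xs e by auto
  then show ?thesis using s e unfolding sound.simps by blast
qed

lemma sound_arrive:
  assumes "sound E s" "e \<notin> E"
  shows "sound (insert e E) (arrive k d f indep e s)"
proof -
  obtain S w P L where s: "s = (S, w, P, L)" by (cases s)
  show ?thesis
    using sound_insert[OF assms[unfolded s]] unfolding s arrive.simps by (rule sound_prune)
qed

text \<open>An exchange never shrinks the closure of a level set. If the evicted \<open>x\<close>
  lies below the level, nothing is lost; otherwise \<open>u\<close> is spanned by the level set,
  replaces \<open>x\<close> in it, and is itself above the level.\<close>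

lemma spanned_accept:
  assumes S: "S \<in> \<M>" "u \<notin> S" "\<And>a. a \<in> S \<Longrightarrow> 0 < w a"
    and u: "insert u {s \<in> S. marg f S u \<le> 2 * w s} \<in> \<M>"
    and a: "spanned \<M> a {s \<in> S. \<theta> \<le> w s}"
    and w': "w' u = marg f S u" "\<And>s. s \<in> exchange indep w S u \<Longrightarrow> s \<noteq> u \<Longrightarrow> w' s = w s"
  shows "spanned \<M> a {s \<in> exchange indep w S u. \<theta> \<le> w' s}"
proof -
  have w_eq: "w' s = w s" if "s \<in> S" "s \<in> exchange indep w S u" for s
    using that S(2) w'(2) by metis
  show ?thesis
    using S(1,2) u
  proof (cases rule: exchange_cases)
    case add
    have "{s \<in> S. \<theta> \<le> w s} \<subseteq> {s \<in> exchange indep w S u. \<theta> \<le> w' s}"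
      using add w_eq by auto
    then show ?thesis by (rule spanned_mono[OF matroid a])
  next
    case (swap x)
    let ?X = "{s \<in> S. \<theta> \<le> w s}"
    show ?thesis
    proof (cases "\<theta> \<le> w x")
      case False
      have "?X \<subseteq> {s \<in> exchange indep w S u. \<theta> \<le> w' s}"
      proof
        fix s assume "s \<in> ?X"
        then have "s \<in> S" "s \<in> exchange indep w S u" "\<theta> \<le> w s" using swap(3) False by auto
        then show "s \<in> {s \<in> exchange indep w S u. \<theta> \<le> w' s}" using w_eq by simp
      qed
      then show ?thesis by (rule spanned_mono[OF matroid a])
    next
      case True
      have "insert u ?X \<notin> \<M>"
      proof
        assume "insert u ?X \<in> \<M>"
        moreover have "insert u {s \<in> S. w x \<le> w s} \<subseteq> insert u ?X" using True by auto
        ultimately show False using swap(5) matroid_subset[OF matroid] by blast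
      qed
      moreover have "insert u (?X - {x}) \<in> \<M>"
        by (rule matroid_subset[OF matroid swap(2)]) auto
      moreover have "?X \<in> \<M>" by (rule matroid_subset[OF matroid S(1)]) auto
      ultimately have "spanned \<M> a (insert u (?X - {x}))"
        using True swap(1) S(2) by (intro spanned_exchange[OF matroid _ _ _ _ _ a]) auto
      moreover have "insert u (?X - {x}) \<subseteq> {s \<in> exchange indep w S u. \<theta> \<le> w' s}"
      proof -
        have "\<theta> \<le> w' u" using True swap(4) S(3)[OF swap(1)] w'(1) by linarith
        then show ?thesis using swap(3) w_eq by auto
      qed
      ultimately show ?thesis by (rule spanned_mono[OF matroid])
    qed
  qed
qed

text \<open>An eviction loses less than half of the value gained, so each accepted element raises
  \<open>sum w S\<close> by at least half its value.\<close>

lemma sum_weights_accept: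
  assumes S: "S \<in> \<M>" "u \<notin> S"
    and u: "insert u {s \<in> S. marg f S u \<le> 2 * w s} \<in> \<M>" "0 < marg f S u"
    and w': "w' u = marg f S u" "\<And>s. s \<in> exchange indep w S u \<Longrightarrow> s \<noteq> u \<Longrightarrow> w' s = w s"
  shows "2 * sum w S + marg f S u \<le> 2 * sum w' (exchange indep w S u)"
proof -
  have fS: "finite S" using matroid_finite[OF matroid S(1)] .
  show ?thesis
    using S(1,2) u(1)
  proof (cases rule: exchange_cases)
    case add
    have "sum w' S = sum w S" using add S(2) w'(2) by (intro sum.cong) auto
    then show ?thesis using add(2) fS S(2) u(2) w'(1) by simp
  next
    case (swap x)
    have "sum w' (S - {x}) = sum w (S - {x})" using swap S(2) w'(2) by (intro sum.cong) auto
    then show ?thesis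
      using swap(3,4) fS S(2) w'(1) sum.remove[OF fS swap(1), of w] by simp
  qed
qed

end

subsection \<open>The potential function\<close>

lemma expectation_bernoulli_bind:
  fixes h :: "'b \<Rightarrow> real"
  assumes "\<And>b. finite (set_pmf (g b))" "0 \<le> p" "p \<le> 1"
  shows "measure_pmf.expectation (bind_pmf (bernoulli_pmf p) g) h =
    p * measure_pmf.expectation (g True) h + (1 - p) * measure_pmf.expectation (g False) h"
  using assms by (subst pmf_expectation_bind[of UNIV]) (auto simp: UNIV_bool)

lemma expectation_bind_finite:
  fixes h :: "'b \<Rightarrow> real"
  assumes "finite (set_pmf p)" "\<And>x. finite (set_pmf (g x))"
  shows "measure_pmf.expectation (bind_pmf p g) h =
    measure_pmf.expectation p (\<lambda>x. measure_pmf.expectation (g x) h)"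
proof -
  have "measure_pmf.expectation (bind_pmf p g) h =
      (\<Sum>a\<in>set_pmf p. pmf p a *\<^sub>R measure_pmf.expectation (g a) h)"
    using assms by (intro pmf_expectation_bind) auto
  also have "\<dots> = measure_pmf.expectation p (\<lambda>x. measure_pmf.expectation (g x) h)"
    using assms(1) by (intro integral_measure_pmf[symmetric]) auto
  finally show ?thesis .
qed

text \<open>Fix the deleted set \<open>D\<close> and an optimal solution \<open>Q\<close> of what remains. A history
  \<open>(K, C, N, r)\<close> records the elements ever added to the solution (\<open>K\<close>), discarded by the coin
  (\<open>C\<close>), and rejected (\<open>N\<close>), together with the marginal value \<open>r\<close> that each of them had when it
  left the pool. The algorithm does not store it; it exists in the analysis only.\<close>

type_synonym 'a history = "'a set \<times> 'a set \<times> 'a set \<times> ('a \<Rightarrow> real)"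

locale robust_target = robust_instance k d V f \<M>
  for k d :: nat and V :: "'a set" and f :: "'a set \<Rightarrow> real" and \<M> :: "'a set set" +
  fixes D Q :: "'a set"
  assumes D: "D \<subseteq> V" "card D \<le> d" and Q: "Q \<in> \<M>" "Q \<subseteq> V - D"
    and optimal: "\<And>R. R \<in> \<M> \<Longrightarrow> R \<subseteq> V - D \<Longrightarrow> f R \<le> f Q"
begin

text \<open>The marginal values of \<open>C\<close> and \<open>N\<close> are bounded over
  \<open>K\<close> rather than \<open>S\<close>: \<open>K\<close> only grows, so the bounds persist,
  whereas an eviction could raise marginal values over \<open>S\<close>.\<close>

fun tracks :: "'a set \<Rightarrow> 'a state \<Rightarrow> 'a history \<Rightarrow> bool" where
  "tracks E (S, w, P, L) (K, C, N, r) \<longleftrightarrow>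
     sound E (S, w, P, L) \<and> P \<union> K \<union> C \<union> N = E \<and>
     P \<inter> (K \<union> C \<union> N) = {} \<and> K \<inter> (C \<union> N) = {} \<and> C \<inter> N = {} \<and> S \<subseteq> K \<and>
     (\<forall>a\<in>S. r a = w a) \<and>
     (\<forall>a\<in>K. 0 < r a \<and> spanned \<M> a {s \<in> S. r a \<le> w s}) \<and>
     (\<forall>a\<in>N. r a \<le> f Q / (100 * real k) \<or> spanned \<M> a {s \<in> S. r a / 2 \<le> w s}) \<and>
     (\<forall>a\<in>C \<union> N. marg f K a \<le> r a) \<and>
     f K \<le> sum r K \<and> sum r K \<le> 2 * sum w S"

text \<open>The second line accounts for the coin: a drawn element of \<open>Q\<close> joins \<open>K\<close> with
  probability 1/3 and \<open>C\<close> with probability 2/3. The third line accounts for the deletions: a bucket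
  has more than \<open>100 * d\<close> elements with values within a factor of 2, so a drawn element contributes
  in expectation at most 1/50 of its value to \<open>D\<close>. The factor 25/6 is the solution of
  \<open>x = 4 + 2 * x / 50\<close>, which makes the coefficient of \<open>sum w S\<close> match at the end.\<close>

fun potential :: "'a history \<Rightarrow> real" where
  "potential (K, C, N, r) =
     sampling_potential f Q K (V - (K \<union> C))
     + (2 * sum r (K \<inter> Q) - sum r (C \<inter> Q))
     - 25/6 * (sum r (K \<inter> D) - sum r K / 50)"

section \<open>Updates of the history\<close>

lemma finite_D: "finite D"
  using D finite_V finite_subset by blast

lemma Q_subset: "Q \<subseteq> V"
  using Q by auto

lemma potential_cong:
  assumes "\<And>a. a \<in> K \<union> C \<Longrightarrow> r a = r' a"
  shows "potential (K, C, N, r) = potential (K, C, N', r')"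
proof -
  have "sum r (K \<inter> Q) = sum r' (K \<inter> Q)" "sum r (C \<inter> Q) = sum r' (C \<inter> Q)"
    "sum r (K \<inter> D) = sum r' (K \<inter> D)" "sum r K = sum r' K"
    using assms by (auto intro!: sum.cong)
  then show ?thesis by simp
qed

text \<open>If more than \<open>d\<close> singletons reach \<open>100 * k\<close> times the value of
  \<open>u\<close>, one of them survives the deletion of \<open>D\<close> and is feasible, so
  \<open>f Q\<close> is at least that large.\<close>

lemma rejected_small_or_spanned:
  assumes L: "distinct xs" "set xs \<subseteq> {x \<in> V. {x} \<in> \<M>}" "L = map (\<lambda>x. f {x}) xs"
    and rej: "rejected k d f indep S w L u"
  shows "marg f S u \<le> f Q / (100 * real k) \<or> spanned \<M> u {s \<in> S. marg f S u / 2 \<le> w s}"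
proof -
  consider "marg f S u \<le> 0" | "d < length (filter (\<lambda>v. 100 * real k * marg f S u \<le> v) L)"
    | "insert u {s \<in> S. marg f S u \<le> 2 * w s} \<notin> \<M>"
    using rej by (auto simp: rejected_def)
  then show ?thesis
  proof cases
    case 1
    have "0 \<le> f Q / (100 * real k)" using nonneg[OF Q_subset] by simp
    then show ?thesis using 1 by linarith
  next
    case 2
    let ?P = "\<lambda>x. 100 * real k * marg f S u \<le> f {x}"
    have "length (filter ?P xs) = card (set (filter ?P xs))"
      using L(1) by (simp only: distinct_card distinct_filter)
    moreover have "length (filter (\<lambda>v. 100 * real k * marg f S u \<le> v) L) = length (filter ?P xs)"
      by (simp add: L(3) filter_map o_def)
    ultimately have "card D < card (set (filter ?P xs))" using 2 D(2) by linarith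
    then have "\<not> set (filter ?P xs) \<subseteq> D" using card_mono[OF finite_D] by (meson not_less)
    then obtain x where x: "x \<in> set xs" "x \<notin> D" "?P x" by auto
    then have "{x} \<in> \<M>" "x \<in> V" using L(2) by auto
    then have "f {x} \<le> f Q" using x by (intro optimal) auto
    moreover have "0 < k" using card_indep[OF \<open>{x} \<in> \<M>\<close>] by simp
    ultimately show ?thesis using x(3) by (simp add: field_simps)
  next
    case 3
    moreover have "{s \<in> S. marg f S u \<le> 2 * w s} = {s \<in> S. marg f S u / 2 \<le> w s}" by auto
    ultimately show ?thesis by (simp add: spanned_def)
  qed
qed

text \<open>Rejected elements move to \<open>N\<close> with their current marginal value, which
  bounds the one over \<open>K\<close> because \<open>S \<subseteq> K\<close>. The potential reads
  \<open>K\<close>, \<open>C\<close> and the values on them only, so it is unchanged.\<close>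

lemma tracks_prune:
  assumes E: "E \<subseteq> V" and t: "tracks E s (K, C, N, r)"
  obtains N' r' where "tracks E (prune k d f indep s) (K, C, N', r')"
    "potential (K, C, N', r') = potential (K, C, N, r)"
proof -
  obtain S w P L where s: "s = (S, w, P, L)" by (cases s)
  let ?R = "{u \<in> P. rejected k d f indep S w L u}"
  let ?N = "N \<union> ?R" and ?r = "\<lambda>a. if a \<in> P then marg f S a else r a"
  note t' = t[unfolded s tracks.simps]
  have disj: "P \<inter> (K \<union> C \<union> N) = {}" "S \<subseteq> K" "P \<union> K \<union> C \<union> N = E" using t' by blast+
  have agree: "?r a = r a" if "a \<in> K \<union> C \<union> N" for a using that disj by auto
  have agree_S: "?r a = r a" if "a \<in> S" for a using that disj agree by blast
  obtain xs where xs: "distinct xs" "set xs = {x \<in> E. {x} \<in> \<M>}" "L = map (\<lambda>x. f {x}) xs"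
    using t' by auto
  have sound: "sound E (S, w, {u \<in> P. \<not> rejected k d f indep S w L u}, L)"
    using t sound_prune[of E s] unfolding s by simp
  have sums: "sum ?r K = sum r K" using agree by (intro sum.cong) auto
  have new: "?r a \<le> f Q / (100 * real k) \<or> spanned \<M> a {s \<in> S. ?r a / 2 \<le> w s}" if "a \<in> ?R" for a
    using rejected_small_or_spanned[OF xs(1) _ xs(3), of S w a] that E xs(2) by auto
  have new': "marg f K a \<le> ?r a" if "a \<in> ?R" for a
  proof -
    have "marg f K a \<le> marg f S a"
      using that disj E by (intro marg_antimono[OF submodular]) auto
    then show ?thesis using that by simp
  qed
  have 1: "{u \<in> P. \<not> rejected k d f indep S w L u} \<union> K \<union> C \<union> ?N = E" using disj by blast
  have 2: "{u \<in> P. \<not> rejected k d f indep S w L u} \<inter> (K \<union> C \<union> ?N) = {}" "K \<inter> (C \<union> ?N) = {}" "C \<inter> ?N = {}"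
    using disj t' by blast+
  have 3: "\<forall>a\<in>S. ?r a = w a" using agree_S t' by simp
  have 4: "\<forall>a\<in>K. 0 < ?r a \<and> spanned \<M> a {s \<in> S. ?r a \<le> w s}" using agree t' by simp
  have 5: "\<forall>a\<in>?N. ?r a \<le> f Q / (100 * real k) \<or> spanned \<M> a {s \<in> S. ?r a / 2 \<le> w s}"
  proof
    fix a assume "a \<in> ?N"
    then consider "a \<in> N" | "a \<in> ?R" by blast
    then show "?r a \<le> f Q / (100 * real k) \<or> spanned \<M> a {s \<in> S. ?r a / 2 \<le> w s}"
    proof cases
      case 1
      then have "?r a = r a" using agree by blast
      then show ?thesis using t' 1 by simp
    next
      case 2
      then show ?thesis by (rule new)
    qed
  qed
  have 6: "\<forall>a\<in>C \<union> ?N. marg f K a \<le> ?r a"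
  proof
    fix a assume "a \<in> C \<union> ?N"
    then consider "a \<in> C \<union> N" | "a \<in> ?R" by blast
    then show "marg f K a \<le> ?r a"
    proof cases
      case 1
      then have "?r a = r a" using agree by blast
      then show ?thesis using t' 1 by simp
    next
      case 2
      then show ?thesis by (rule new')
    qed
  qed
  have 7: "f K \<le> sum ?r K" "sum ?r K \<le> 2 * sum w S" unfolding sums using t' by blast+
  have "tracks E (prune k d f indep s) (K, C, ?N, ?r)"
    unfolding s prune.simps tracks.simps using sound 1 2 disj(2) 3 4 5 6 7 by blast
  moreover have "potential (K, C, ?N, ?r) = potential (K, C, N, r)"
    by (rule potential_cong) (use agree in blast)
  ultimately show ?thesis by (rule that)
qed

text \<open>The value of \<open>u\<close> over \<open>K\<close> is at most the one over
  \<open>S\<close>, spans survive the exchange, and \<open>sum r K\<close> grows by the marginal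
  value while \<open>sum w S\<close> grows by at least half of it.\<close>

lemma tracks_accept:
  assumes E: "E \<subseteq> V" and t: "tracks E (S, w, P, L) (K, C, N, r)" and p: "pruned (S, w, P, L)" and u: "u \<in> P"
  shows "tracks E (accept f indep u (S, w, P, L)) (insert u K, C, N, r(u := marg f S u))"
proof -
  let ?T = "exchange indep w S u" and ?a = "marg f S u"
  let ?w = "\<lambda>a. if a = u then ?a else if a \<in> ?T then w a else 0"
  let ?r = "r(u := ?a)"
  note t' = t[unfolded tracks.simps]
  have sound: "sound E (S, w, P, L)" using t' by blast
  have S: "S \<in> \<M>" "\<And>a. a \<in> S \<Longrightarrow> 0 < w a" using sound by auto
  have disj: "P \<inter> (K \<union> C \<union> N) = {}" "S \<subseteq> K" "P \<union> K \<union> C \<union> N = E" "K \<inter> (C \<union> N) = {}" using t' by blast+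
  have uK: "u \<notin> K" "u \<notin> S" "u \<notin> C" "u \<notin> N" "u \<in> V" using disj u E by auto
  have KV: "K \<subseteq> V" using disj E by auto
  have fK: "finite K" using KV finite_V finite_subset by blast
  have nr: "\<not> rejected k d f indep S w L u" using p u by simp
  note a = not_rejectedD(1,2)[OF nr]
  have sub: "?T \<subseteq> insert u S" by (rule exchange_subset)
  have 0: "sound E (?T, ?w, P - {u}, L)"
    using sound_accept[OF E sound p, of u] u uK(2) by simp
  have 1: "P - {u} \<union> insert u K \<union> C \<union> N = E" "(P - {u}) \<inter> (insert u K \<union> C \<union> N) = {}"
      "insert u K \<inter> (C \<union> N) = {}" "?T \<subseteq> insert u K"
    using disj u uK sub by blast+
  have "C \<inter> N = {}" using t' by blast
  have 2: "\<forall>a\<in>?T. ?r a = ?w a"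
  proof
    fix a assume a: "a \<in> ?T"
    have "r a = w a" if "a \<noteq> u" using that a sub t' by blast
    then show "?r a = ?w a" using a by simp
  qed
  have sp: "spanned \<M> b {s \<in> ?T. \<theta> \<le> ?w s}" if "spanned \<M> b {s \<in> S. \<theta> \<le> w s}" for b \<theta>
    by (rule spanned_accept[OF S(1) uK(2) S(2) a(2) that]) auto
  have 3: "\<forall>b\<in>insert u K. 0 < ?r b \<and> spanned \<M> b {s \<in> ?T. ?r b \<le> ?w s}"
  proof
    fix b assume "b \<in> insert u K"
    then consider "b = u" | "b \<in> K" "b \<noteq> u" by blast
    then show "0 < ?r b \<and> spanned \<M> b {s \<in> ?T. ?r b \<le> ?w s}"
    proof cases
      case 1
      then show ?thesis using a(1) exchange_mem[of u indep w S] by (simp add: spanned_def)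
    next
      case 2
      then have "0 < r b" "spanned \<M> b {s \<in> S. r b \<le> w s}" using t' by blast+
      then show ?thesis using 2 sp by simp
    qed
  qed
  have 4: "\<forall>b\<in>N. ?r b \<le> f Q / (100 * real k) \<or> spanned \<M> b {s \<in> ?T. ?r b / 2 \<le> ?w s}"
  proof
    fix b assume b: "b \<in> N"
    then have eq: "?r b = r b" using uK by auto
    have "r b \<le> f Q / (100 * real k) \<or> spanned \<M> b {s \<in> S. r b / 2 \<le> w s}" using t' b by blast
    then show "?r b \<le> f Q / (100 * real k) \<or> spanned \<M> b {s \<in> ?T. ?r b / 2 \<le> ?w s}"
      unfolding eq using sp by blast
  qed
  have 5: "\<forall>b\<in>C \<union> N. marg f (insert u K) b \<le> ?r b"
  proof
    fix b assume b: "b \<in> C \<union> N"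
    then have "marg f (insert u K) b \<le> marg f K b"
      using uK KV disj E by (intro marg_antimono[OF submodular]) auto
    also have "\<dots> \<le> r b" using t' b by blast
    finally show "marg f (insert u K) b \<le> ?r b" using b uK by auto
  qed
  have "sum ?r K = sum r K" using uK by (intro sum.cong) auto
  then have sum_r: "sum ?r (insert u K) = sum r K + ?a" using uK fK by simp
  have "marg f K u \<le> ?a" using uK disj KV by (intro marg_antimono[OF submodular]) auto
  then have 6: "f (insert u K) \<le> sum ?r (insert u K)"
    unfolding sum_r using t' by (auto simp: marg_def)
  have "2 * sum w S + ?a \<le> 2 * sum ?w ?T"
    by (rule sum_weights_accept[OF S(1) uK(2) a(2,1)]) auto
  then have 7: "sum ?r (insert u K) \<le> 2 * sum ?w ?T" unfolding sum_r using t' by linarith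
  show ?thesis unfolding accept.simps tracks.simps using 0 1 \<open>C \<inter> N = {}\<close> 2 3 4 5 6 7 by blast
qed

lemma tracks_discard:
  assumes E: "E \<subseteq> V" and t: "tracks E (S, w, P, L) (K, C, N, r)" and u: "u \<in> P"
  shows "tracks E (discard u (S, w, P, L)) (K, insert u C, N, r(u := marg f S u))"
proof -
  let ?r = "r(u := marg f S u)"
  note t' = t[unfolded tracks.simps]
  have disj: "P \<inter> (K \<union> C \<union> N) = {}" "S \<subseteq> K" "P \<union> K \<union> C \<union> N = E" using t' by blast+
  have uK: "u \<notin> K" "u \<notin> S" "u \<notin> C" "u \<notin> N" "u \<in> V" using disj u E by auto
  have 0: "sound E (S, w, P - {u}, L)" using t' sound_discard[of E "(S, w, P, L)" u] by simp
  have 1: "P - {u} \<union> K \<union> insert u C \<union> N = E" "(P - {u}) \<inter> (K \<union> insert u C \<union> N) = {}"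
      "K \<inter> (insert u C \<union> N) = {}" "insert u C \<inter> N = {}"
    using disj u uK t' by blast+
  have "marg f K u \<le> marg f S u"
    using uK disj E by (intro marg_antimono[OF submodular]) auto
  then have 2: "\<forall>a\<in>insert u C \<union> N. marg f K a \<le> ?r a" using t' by auto
  have 3: "\<forall>a\<in>S. ?r a = w a" using t' uK by auto
  have 4: "\<forall>a\<in>K. 0 < ?r a \<and> spanned \<M> a {s \<in> S. ?r a \<le> w s}"
  proof
    fix a assume a: "a \<in> K"
    then have eq: "?r a = r a" using uK by auto
    show "0 < ?r a \<and> spanned \<M> a {s \<in> S. ?r a \<le> w s}" unfolding eq using t' a by blast
  qed
  have 5: "\<forall>a\<in>N. ?r a \<le> f Q / (100 * real k) \<or> spanned \<M> a {s \<in> S. ?r a / 2 \<le> w s}"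
  proof
    fix a assume a: "a \<in> N"
    then have eq: "?r a = r a" using uK by auto
    show "?r a \<le> f Q / (100 * real k) \<or> spanned \<M> a {s \<in> S. ?r a / 2 \<le> w s}" unfolding eq using t' a by blast
  qed
  have "sum ?r K = sum r K" using uK by (intro sum.cong) auto
  then have 6: "f K \<le> sum ?r K" "sum ?r K \<le> 2 * sum w S" using t' by simp_all
  show ?thesis unfolding discard.simps tracks.simps using 0 1 2 3 4 5 6 disj(2) by blast
qed

text \<open>For \<open>u\<close> in \<open>Q\<close> the expected change of the second term is 1/3 *
  2 - 2/3 = 0 times its value. The deletion term changes with probability 1/3, hence 25/18 = (25/6)
  / 3; its error is compensated only on average over a bucket.\<close>

lemma potential_draw:
  assumes E: "E \<subseteq> V" and t: "tracks E (S, w, P, L) (K, C, N, r)" and u: "u \<in> P"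
  defines "a \<equiv> marg f S u"
  shows "potential (K, C, N, r) - 25/18 * ((if u \<in> D then a else 0) - a / 50)
    \<le> 1/3 * potential (insert u K, C, N, r(u := a)) + 2/3 * potential (K, insert u C, N, r(u := a))"
proof -
  let ?r = "r(u := a)"
  note t' = t[unfolded tracks.simps]
  have disj: "P \<inter> (K \<union> C \<union> N) = {}" "P \<union> K \<union> C \<union> N = E" using t' by blast+
  have uK: "u \<notin> K" "u \<notin> C" "u \<in> V" using disj u E by auto
  have fin: "finite K" "finite C" "K \<subseteq> V" using disj E finite_V finite_subset by auto
  have keep: "sum ?r X = sum r X" if "u \<notin> X" for X using that by (intro sum.cong) auto
  have ins: "sum ?r (insert u X \<inter> Y) = sum r (X \<inter> Y) + (if u \<in> Y then a else 0)"
    if "u \<notin> X" "finite X" for X Y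
    using that keep[of "X \<inter> Y"] by simp
  have K: "sum ?r (insert u K) = sum r K + a" using ins[OF uK(1) fin(1), of UNIV] by simp
  have sets: "V - (insert u K \<union> C) = V - (K \<union> C) - {u}" "V - (K \<union> insert u C) = V - (K \<union> C) - {u}" by auto
  have "sampling_potential f Q K (V - (K \<union> C))
    \<le> 1/3 * sampling_potential f Q (insert u K) (V - (K \<union> C) - {u})
    + 2/3 * sampling_potential f Q K (V - (K \<union> C) - {u})"
    by (rule sampling_potential_step[OF submodular finite_V Q_subset fin(3)]) (use uK in auto)
  moreover have "sum ?r (K \<inter> Q) = sum r (K \<inter> Q)" "sum ?r (C \<inter> Q) = sum r (C \<inter> Q)"
    "sum ?r (K \<inter> D) = sum r (K \<inter> D)" "sum ?r K = sum r K" 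
    by (rule keep, use uK in blast)+
  ultimately show ?thesis
    unfolding potential.simps sets K ins[OF uK(1) fin(1)] ins[OF uK(2) fin(2)]
    by (cases "u \<in> Q"; cases "u \<in> D"; simp only: if_True if_False; argo)
qed

text \<open>Each deleted element of the bucket is worth at most twice any \<open>v\<close> in it, so
  \<open>D\<close> takes at most \<open>2 * d\<close> times the value of \<open>v\<close>. Averaging
  over \<open>v\<close> and \<open>100 * d < card B\<close> give 2/100 = 1/50.\<close>

lemma bucket_deletions:
  assumes B: "is_bucket d f S P B" and pos: "\<And>u. u \<in> B \<Longrightarrow> 0 < marg f S u"
  shows "(\<Sum>u\<in>B. if u \<in> D then marg f S u else 0) \<le> (\<Sum>u\<in>B. marg f S u) / 50"
proof -
  let ?a = "marg f S"
  have fB: "finite B" "B \<noteq> {}" using is_bucket_finite[OF B] by auto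
  have size: "100 * real d < real (card B)" using B unfolding is_bucket_def by linarith
  have eq: "(\<Sum>u\<in>B. if u \<in> D then ?a u else 0) = sum ?a (B \<inter> D)"
    using fB by (simp add: sum.inter_restrict)
  have "sum ?a (B \<inter> D) \<le> 2 * real d * ?a v" if v: "v \<in> B" for v
  proof -
    have "sum ?a (B \<inter> D) \<le> real (card (B \<inter> D)) * (2 * ?a v)"
      using B v by (intro sum_bounded_above) (auto simp: is_bucket_def)
    also have "card (B \<inter> D) \<le> d" using card_mono[OF finite_D, of "B \<inter> D"] D(2) by auto
    then have "real (card (B \<inter> D)) * (2 * ?a v) \<le> real d * (2 * ?a v)"
      using pos[OF v] by (intro mult_right_mono) auto
    finally show ?thesis by simp
  qed
  then have "(\<Sum>v\<in>B. sum ?a (B \<inter> D)) \<le> (\<Sum>v\<in>B. 2 * real d * ?a v)" by (rule sum_mono)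
  then have "real (card B) * sum ?a (B \<inter> D) \<le> 2 * real d * sum ?a B"
    by (simp add: sum_distrib_left)
  also have "\<dots> \<le> real (card B) / 50 * sum ?a B"
    using size pos by (intro mult_right_mono sum_nonneg) (auto intro: less_imp_le)
  finally have "real (card B) * sum ?a (B \<inter> D) \<le> real (card B) * (sum ?a B / 50)" by simp
  then show ?thesis unfolding eq using fB by (simp add: card_gt_0_iff mult_le_cancel_left)
qed

text \<open>The potential is a submartingale along the loop. The function \<open>h\<close> is
  arbitrary so that it can stand for the expected outcome of the remaining stream.\<close>

lemma drain_potential:
  assumes E: "E \<subseteq> V" and h: "\<And>s' \<gamma>'. tracks E s' \<gamma>' \<Longrightarrow> pruned s' \<Longrightarrow> potential \<gamma>' \<le> h s'"
  shows "tracks E s \<gamma> \<Longrightarrow> pruned s \<Longrightarrow>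
    potential \<gamma> \<le> measure_pmf.expectation (drain k d f indep n s) h"
proof (induction n arbitrary: s \<gamma>)
  case 0
  then show ?case using h by simp
next
  case (Suc n)
  obtain S w P L where s: "s = (S, w, P, L)" by (cases s)
  obtain K C N r where \<gamma>: "\<gamma> = (K, C, N, r)" by (cases \<gamma>)
  note t = Suc.prems(1)[unfolded s \<gamma>] and p = Suc.prems(2)[unfolded s]
  show ?case
  proof (cases "\<exists>B. is_bucket d f S P B")
    case False
    show ?thesis unfolding s drain_Suc_no_bucket[OF False] using h[OF Suc.prems] s by simp
  next
    case True
    obtain B where B: "is_bucket d f S P B"
      "drain k d f indep (Suc n) s = bind_pmf (pmf_of_set B) (\<lambda>u. bind_pmf (bernoulli_pmf (1/3))
        (\<lambda>b. drain k d f indep n (if b then prune k d f indep (accept f indep u s) else discard u s)))"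
      unfolding s by (rule drain_Suc_bucket[OF True])
    have fB: "finite B" "B \<noteq> {}" using is_bucket_finite[OF B(1)] by auto
    let ?a = "marg f S"
    let ?e = "\<lambda>u. measure_pmf.expectation (bind_pmf (bernoulli_pmf (1/3))
        (\<lambda>b. drain k d f indep n (if b then prune k d f indep (accept f indep u s) else discard u s))) h"
    have draw: "potential \<gamma> - 25/18 * ((if u \<in> D then ?a u else 0) - ?a u / 50) \<le> ?e u" if "u \<in> B" for u
    proof -
      have u: "u \<in> P" using B(1) that by (auto simp: is_bucket_def)
      obtain N' r' where N': "tracks E (prune k d f indep (accept f indep u s)) (insert u K, C, N', r')"
        "potential (insert u K, C, N', r') = potential (insert u K, C, N, r(u := ?a u))"
        using tracks_prune[OF E tracks_accept[OF E t p u]] unfolding s by blast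
      have "potential (insert u K, C, N, r(u := ?a u)) \<le>
          measure_pmf.expectation (drain k d f indep n (prune k d f indep (accept f indep u s))) h"
        using Suc.IH[OF N'(1) pruned_prune] N'(2) by simp
      moreover have "potential (K, insert u C, N, r(u := ?a u)) \<le>
          measure_pmf.expectation (drain k d f indep n (discard u s)) h"
        using tracks_discard[OF E t u] pruned_discard[OF Suc.prems(2)] unfolding s by (rule Suc.IH)
      moreover have "?e u = 1/3 * measure_pmf.expectation (drain k d f indep n (prune k d f indep (accept f indep u s))) h
          + 2/3 * measure_pmf.expectation (drain k d f indep n (discard u s)) h"
        by (subst expectation_bernoulli_bind) (simp_all add: finite_drain)
      ultimately show ?thesis using potential_draw[OF E t u] unfolding \<gamma> by linarith
    qed
    have pos: "0 < ?a u" if "u \<in> B" for u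
    proof -
      have "\<not> rejected k d f indep S w L u" using that B(1) p by (auto simp: is_bucket_def)
      then show ?thesis by (rule not_rejectedD(1))
    qed
    \<comment> \<open>Averaged over the bucket, the deletion error has the favourable sign.\<close>
    have "real (card B) * potential \<gamma> \<le> real (card B) * potential \<gamma>
        - 25/18 * ((\<Sum>u\<in>B. if u \<in> D then ?a u else 0) - (\<Sum>u\<in>B. ?a u) / 50)"
      using bucket_deletions[OF B(1) pos] by simp
    also have "\<dots> = (\<Sum>u\<in>B. potential \<gamma> - 25/18 * ((if u \<in> D then ?a u else 0) - ?a u / 50))"
      by (simp only: sum_subtractf sum_constant sum_distrib_left[symmetric] sum_divide_distrib[symmetric])
    also have "\<dots> \<le> (\<Sum>u\<in>B. ?e u)" by (rule sum_mono[OF draw])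
    finally have "potential \<gamma> \<le> (\<Sum>u\<in>B. ?e u) / real (card B)"
      using fB by (simp add: field_simps card_gt_0_iff)
    also have "\<dots> = (\<Sum>u\<in>B. ?e u /\<^sub>R real (card B))"
      by (simp only: real_scaleR_def divide_inverse_commute sum_distrib_left)
    also have "\<dots> = measure_pmf.expectation (drain k d f indep (Suc n) s) h"
      unfolding B(2)
      by (rule pmf_expectation_bind_pmf_of_set[symmetric, OF fB(2,1)])
        (simp only: set_bind_pmf, intro finite_UN_I finite_drain, simp)
    finally show ?thesis .
  qed
qed

lemma tracks_arrive:
  assumes E: "insert e E \<subseteq> V" "e \<notin> E" and t: "tracks E s (K, C, N, r)"
  obtains N' r' where "tracks (insert e E) (arrive k d f indep e s) (K, C, N', r')"
    "potential (K, C, N', r') = potential (K, C, N, r)"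
proof -
  obtain S w P L where s: "s = (S, w, P, L)" by (cases s)
  let ?s = "(S, w, insert e P, if {e} \<in> \<M> then L @ [f {e}] else L)"
  note t' = t[unfolded s tracks.simps]
  have new: "e \<notin> K \<union> C \<union> N" "e \<notin> S" using t' E(2) by blast+
  have sound: "sound (insert e E) ?s" using t' E(2) by (blast intro: sound_insert)
  have "insert e P \<union> K \<union> C \<union> N = insert e E" "insert e P \<inter> (K \<union> C \<union> N) = {}" using t' new by blast+
  then have "tracks (insert e E) ?s (K, C, N, r)"
    unfolding tracks.simps using t' sound by blast
  from tracks_prune[OF E(1) this] show ?thesis
    using that unfolding s arrive.simps by blast
qed

lemma state_step_potential:
  assumes E: "insert e E \<subseteq> V" "e \<notin> E"
    and h: "\<And>s' \<gamma>'. tracks (insert e E) s' \<gamma>' \<Longrightarrow> pruned s' \<Longrightarrow> potential \<gamma>' \<le> h s'"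
    and t: "tracks E s \<gamma>"
  shows "potential \<gamma> \<le> measure_pmf.expectation (state_step k d f indep e s) h"
proof -
  obtain S w P L where s: "s = (S, w, P, L)" by (cases s)
  obtain K C N r where \<gamma>: "\<gamma> = (K, C, N, r)" by (cases \<gamma>)
  obtain N' r' where N': "tracks (insert e E) (arrive k d f indep e s) (K, C, N', r')"
    "potential (K, C, N', r') = potential (K, C, N, r)"
    using t unfolding \<gamma> by (rule tracks_arrive[OF E])
  have "pruned (arrive k d f indep e s)" unfolding s arrive.simps by (rule pruned_prune)
  from drain_potential[OF E(1) h N'(1) this] show ?thesis
    unfolding \<gamma> N'(2) s state_step.simps .
qed

lemma run_potential:
  assumes h: "\<And>s' \<gamma>'. tracks V s' \<gamma>' \<Longrightarrow> pruned s' \<Longrightarrow> potential \<gamma>' \<le> h s'"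
  shows "distinct es \<Longrightarrow> set es \<inter> E = {} \<Longrightarrow> set es \<union> E = V \<Longrightarrow> tracks E s \<gamma> \<Longrightarrow> pruned s \<Longrightarrow>
    potential \<gamma> \<le> measure_pmf.expectation (run k d f \<M> es s) h"
proof (induction es arbitrary: E s \<gamma>)
  case Nil
  then show ?case using h by simp
next
  case (Cons e es)
  \<comment> \<open>The expected value of the remaining run takes the role of \<open>h\<close> for a
    single arrival.\<close>
  have "potential \<gamma> \<le> measure_pmf.expectation (state_step k d f indep e s)
      (\<lambda>s. measure_pmf.expectation (run k d f \<M> es s) h)"
  proof (rule state_step_potential[OF _ _ _ Cons.prems(4)])
    show "insert e E \<subseteq> V" "e \<notin> E" using Cons.prems by auto
    fix s' \<gamma>' assume "tracks (insert e E) s' \<gamma>'" "pruned s'"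
    then show "potential \<gamma>' \<le> measure_pmf.expectation (run k d f \<M> es s') h"
      by (rule Cons.IH[rotated 3]) (use Cons.prems in auto)
  qed
  then show ?case
    unfolding run.simps by (subst expectation_bind_finite) (simp_all only: finite_state_step finite_run)
qed

section \<open>Phase II and the closing inequality\<close>

definition best_value :: "'a set \<Rightarrow> real" where
  "best_value W = f (best f indep (W - D))"

lemma best_optimal:
  assumes "W \<subseteq> V"
  shows "best f indep (W - D) \<subseteq> W - D" "best f indep (W - D) \<in> \<M>"
    "\<And>R. R \<in> \<M> \<Longrightarrow> R \<subseteq> W - D \<Longrightarrow> f R \<le> best_value W"
proof -
  let ?A = "{R. R \<subseteq> W - D \<and> R \<in> \<M>}"
  have "finite ?A" using finite_indep_sets by (auto intro: finite_subset)
  moreover have "{} \<in> ?A" using matroid by (auto simp: matroid_def)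
  ultimately have "Max (f ` ?A) \<in> f ` ?A" "\<And>R. R \<in> ?A \<Longrightarrow> f R \<le> Max (f ` ?A)"
    by (auto intro!: Max_in)
  then obtain B where B: "B \<in> ?A" "\<And>R. R \<in> ?A \<Longrightarrow> f R \<le> f B" by (auto simp: image_iff)
  have "is_arg_max f (\<lambda>R. R \<subseteq> W - D \<and> R \<in> \<M>) B"
    using B by (force simp: is_arg_max_def not_less)
  then have "is_arg_max f (\<lambda>R. R \<subseteq> W - D \<and> R \<in> \<M>) (best f indep (W - D))"
    unfolding best_def arg_max_def by (rule someI)
  then show "best f indep (W - D) \<subseteq> W - D" "best f indep (W - D) \<in> \<M>"
    "\<And>R. R \<in> \<M> \<Longrightarrow> R \<subseteq> W - D \<Longrightarrow> f R \<le> best_value W"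
    unfolding best_value_def is_arg_max_def by (auto simp: not_less)
qed

text \<open>Decompose \<open>Q\<close> along \<open>P\<close>, \<open>K\<close>, \<open>C\<close>
  and \<open>N\<close>. The pool part and \<open>S - D\<close> are feasible for Phase II, the
  discarded part cancels against the potential, and the rejected part is either negligible or paid
  for by \<open>sum w S\<close> through its span.\<close>

lemma potential_final:
  assumes t: "tracks V s \<gamma>"
  shows "potential \<gamma> \<le> 31/6 * best_value (held s) + f Q / 100"
proof -
  obtain S w P L where s: "s = (S, w, P, L)" by (cases s)
  obtain K C N r where \<gamma>: "\<gamma> = (K, C, N, r)" by (cases \<gamma>)
  note t' = t[unfolded s \<gamma> tracks.simps]
  have cover: "P \<union> K \<union> C \<union> N = V" and SK: "S \<subseteq> K" and KCN: "K \<inter> (C \<union> N) = {}" "C \<inter> N = {}"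
    and PKCN: "P \<inter> (K \<union> C \<union> N) = {}"
    using t' by blast+
  have S: "S \<in> \<M>" "\<And>a. a \<in> S \<Longrightarrow> 0 < w a" "\<And>X. X \<subseteq> S \<Longrightarrow> sum w X \<le> f X" using t' by auto
  have rw: "\<And>a. a \<in> S \<Longrightarrow> r a = w a" and r_pos: "\<And>a. a \<in> K \<Longrightarrow> 0 < r a" using t' by blast+
  have fin: "finite K" "finite C" "finite N" "finite S" "finite Q"
    using cover SK Q_subset finite_V by (auto intro: finite_subset)
  have held: "held s \<subseteq> V" "held s = S \<union> P" using s SK cover by auto
  let ?A = "best_value (held s)"
  let ?R = "Q \<inter> P" and ?N1 = "{a \<in> N \<inter> Q. r a \<le> f Q / (100 * real k)}"
  let ?N2 = "{a \<in> N \<inter> Q. \<not> r a \<le> f Q / (100 * real k)}"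
  have fR: "f ?R \<le> ?A"
    using Q held by (intro best_optimal(3) matroid_subset[OF matroid Q(1)]) auto
  have fS: "sum w S - sum r (K \<inter> D) \<le> ?A"
  proof -
    have "sum r (S \<inter> D) \<le> sum r (K \<inter> D)"
    proof (rule sum_mono2)
      show "0 \<le> r a" if "a \<in> K \<inter> D - S \<inter> D" for a using that r_pos[of a] by auto
    qed (use fin SK in auto)
    then have "sum w S - sum r (K \<inter> D) \<le> sum w S - sum r (S \<inter> D)" by simp
    also have "sum r (S \<inter> D) = sum w (S \<inter> D)" using rw by (intro sum.cong) auto
    also have "sum w S - sum w (S \<inter> D) = sum w (S - D)"
      using fin(4) by (simp add: sum.Int_Diff[of S w D])
    also have "\<dots> \<le> f (S - D)" by (rule S(3)) auto
    also have "\<dots> \<le> ?A"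
      using held by (intro best_optimal(3) matroid_subset[OF matroid S(1)]) auto
    finally show ?thesis .
  qed
  have "f (Q \<union> K) \<le> f (K \<union> ?R) + (\<Sum>u\<in>Q \<inter> (C \<union> N). marg f K u)"
  proof -
    have "f ((K \<union> ?R) \<union> Q \<inter> (C \<union> N)) \<le> f (K \<union> ?R) + (\<Sum>u\<in>Q \<inter> (C \<union> N). marg f K u)"
      using fin cover KCN PKCN Q_subset by (intro submodular_union_le_sum_marg[OF submodular]) auto
    moreover have "(K \<union> ?R) \<union> Q \<inter> (C \<union> N) = Q \<union> K" using cover Q_subset by blast
    ultimately show ?thesis by simp
  qed
  also have "f (K \<union> ?R) \<le> f K + f ?R"
  proof -
    have sub: "K \<subseteq> V" "?R \<subseteq> V" "K \<inter> ?R \<subseteq> V" using cover by blast+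
    show ?thesis using submodular_onD[OF submodular sub(1,2)] nonneg[OF sub(3)] by linarith
  qed
  also have "(\<Sum>u\<in>Q \<inter> (C \<union> N). marg f K u) \<le> sum r (Q \<inter> (C \<union> N))"
    using t' by (intro sum_mono) blast
  also have "Q \<inter> (C \<union> N) = (C \<inter> Q) \<union> (N \<inter> Q)" by blast
  also have "sum r \<dots> = sum r (C \<inter> Q) + sum r (N \<inter> Q)"
    using fin KCN by (intro sum.union_disjoint) auto
  also have "N \<inter> Q = ?N1 \<union> ?N2" by blast
  also have "sum r \<dots> = sum r ?N1 + sum r ?N2"
    using fin by (intro sum.union_disjoint) auto
  \<comment> \<open>At most \<open>k\<close> elements of \<open>Q\<close>, each worth at most
    \<open>f Q / (100 * k)\<close>.\<close>
  also have "sum r ?N1 \<le> f Q / 100"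
  proof -
    have "sum r ?N1 \<le> real (card ?N1) * (f Q / (100 * real k))" by (intro sum_bounded_above) auto
    also have "\<dots> \<le> real k * (f Q / (100 * real k))"
    proof (intro mult_right_mono)
      have "card ?N1 \<le> card Q" using fin by (intro card_mono) auto
      then show "real (card ?N1) \<le> real k" using card_indep[OF Q(1)] by simp
    qed (use nonneg[OF Q_subset] in simp)
    also have "\<dots> \<le> f Q / 100" using nonneg[OF Q_subset] by (cases "k = 0") auto
    finally show ?thesis .
  qed
  finally have bound: "f (Q \<union> K) \<le> f K + f ?R + (sum r (C \<inter> Q) + (f Q / 100 + sum r ?N2))"
    by simp
  have matroid_bound: "sum r ?N2 / 2 + sum r (K \<inter> Q) \<le> sum w S"
  proof -
    \<comment> \<open>Elements of \<open>K\<close> are charged at full value and rejected ones at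
      half, so a single application of the matroid bound covers both.\<close>
    let ?t = "\<lambda>a. if a \<in> K then r a else r a / 2"
    let ?T = "?N2 \<union> (K \<inter> Q)"
    have "sum ?t ?T \<le> sum w S"
    proof (rule matroid_spanned_weight[OF matroid _ S(1)])
      show "?T \<in> \<M>" by (rule matroid_subset[OF matroid Q(1)]) auto
      fix a assume a: "a \<in> ?T"
      show "spanned \<M> a {s \<in> S. ?t a \<le> w s}"
      proof (cases "a \<in> K")
        case True
        then have "spanned \<M> a {s \<in> S. r a \<le> w s}" using t' by blast
        then show ?thesis using True by simp
      next
        case False
        then have "a \<in> N" "\<not> r a \<le> f Q / (100 * real k)" using a by auto
        then have "spanned \<M> a {s \<in> S. r a / 2 \<le> w s}" using t' by blast
        then show ?thesis using False by simp
      qed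
    qed (use S(2) in \<open>auto intro: less_imp_le\<close>)
    also have "sum ?t ?T = sum ?t ?N2 + sum ?t (K \<inter> Q)"
      using fin KCN by (intro sum.union_disjoint) auto
    also have "sum ?t ?N2 = (\<Sum>a\<in>?N2. r a / 2)" using KCN by (intro sum.cong) auto
    also have "\<dots> = sum r ?N2 / 2" by (rule sum_divide_distrib[symmetric])
    also have "sum ?t (K \<inter> Q) = sum r (K \<inter> Q)" by (intro sum.cong) auto
    finally show ?thesis .
  qed
  have "Min ((\<lambda>X. f (Q \<union> K \<union> X)) ` Pow (V - (K \<union> C))) \<le> f (Q \<union> K \<union> {})"
    using finite_V by (intro Min_le imageI) auto
  then have "sampling_potential f Q K (V - (K \<union> C)) \<le> f (Q \<union> K)"
    unfolding sampling_potential_def by simp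
  then have "potential \<gamma> \<le> f (Q \<union> K) + (2 * sum r (K \<inter> Q) - sum r (C \<inter> Q))
     - 25/6 * (sum r (K \<inter> D) - sum r K / 50)"
    unfolding \<gamma> potential.simps by simp
  moreover have "f K \<le> sum r K" "sum r K \<le> 2 * sum w S" using t' by blast+
  \<comment> \<open>The coefficient of \<open>sum w S\<close> is 2 from the rejected elements plus 2
    * (1 + 1/12) from \<open>f K\<close> and the deletion term, in total 25/6. The pool part of
    \<open>Q\<close> adds 1, which makes 31/6.\<close>
  ultimately show ?thesis using bound matroid_bound fR fS by argo
qed

lemma tracks_initial: "tracks {} initial_state ({}, {}, {}, \<lambda>_. 0)"
  using matroid f_empty by (auto simp: initial_state_def matroid_def)

lemma pruned_initial: "pruned initial_state"
  by (simp add: initial_state_def)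

text \<open>The minimum in the sampling potential is nonnegative, which leaves 2/3 of
  \<open>f Q\<close>.\<close>

lemma potential_initial: "2/3 * f Q \<le> potential ({}, {}, {}, r)"
proof -
  have "Min ((\<lambda>X. f (Q \<union> {} \<union> X)) ` Pow (V - ({} \<union> {}))) \<ge> 0"
    using finite_V Q_subset by (intro Min.boundedI) (auto intro!: nonneg)
  then show ?thesis by (simp add: sampling_potential_def)
qed

lemma run_approximation:
  assumes es: "distinct es" "set es = V"
  shows "f Q \<le> 9.435 * measure_pmf.expectation (run k d f \<M> es initial_state) (\<lambda>s. best_value (held s))"
proof -
  let ?p = "run k d f \<M> es initial_state"
  let ?E = "measure_pmf.expectation ?p (\<lambda>s. best_value (held s))"
  have int: "integrable (measure_pmf ?p) h" for h :: "'a state \<Rightarrow> real"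
    by (rule integrable_measure_pmf_finite[OF finite_run])
  have "2/3 * f Q \<le> measure_pmf.expectation ?p (\<lambda>s. 31/6 * best_value (held s) + f Q / 100)"
    using potential_initial run_potential[OF potential_final es(1) _ _ tracks_initial pruned_initial] es(2)
    by (meson Int_empty_right Un_empty_right order_trans)
  also have "\<dots> = 31/6 * ?E + f Q / 100" using int by simp
  finally have "(2/3 - 1/100) * f Q \<le> 31/6 * ?E" by argo
  \<comment> \<open>The factor obtained is (31/6) / (197/300) = 1550/197, below 7.9.\<close>
  then show ?thesis using nonneg[OF Q_subset] by simp
qed

end

subsection \<open>The size of the pool\<close>

fun pool :: "'a state \<Rightarrow> 'a set" where
  "pool (S, w, P, L) = P"

fun drained :: "nat \<Rightarrow> ('a set \<Rightarrow> real) \<Rightarrow> 'a state \<Rightarrow> bool" where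
  "drained d f (S, w, P, L) \<longleftrightarrow> (\<nexists>B. is_bucket d f S P B)"

text \<open>A draw removes \<open>u\<close> from the pool in either outcome, so exhausted fuel means
  an empty pool, and buckets are nonempty.\<close>

lemma drained_drain:
  assumes "finite (pool s)" "card (pool s) \<le> n" "s' \<in> set_pmf (drain k d F I n s)"
  shows "drained d F s'"
  using assms
proof (induction n arbitrary: s)
  case 0
  obtain S w P L where s: "s = (S, w, P, L)" by (cases s)
  have "P = {}" using 0 s by simp
  then show ?case using 0 s by (auto simp: is_bucket_def)
next
  case (Suc n)
  obtain S w P L where s: "s = (S, w, P, L)" by (cases s)
  show ?case
  proof (cases "\<exists>B. is_bucket d F S P B")
    case True
    obtain B where B: "is_bucket d F S P B" "set_pmf (pmf_of_set B) = B"
      "drain k d F I (Suc n) s = bind_pmf (pmf_of_set B) (\<lambda>u. bind_pmf (bernoulli_pmf (1/3))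
        (\<lambda>b. drain k d F I n (if b then prune k d F I (accept F I u s) else discard u s)))"
      unfolding s by (rule drain_Suc_bucket[OF True])
    obtain u b where u: "u \<in> B" and s': "s' \<in> set_pmf (drain k d F I n
        (if b then prune k d F I (accept F I u s) else discard u s))"
      using Suc.prems(3) unfolding B(3) set_bind_pmf B(2) by blast
    let ?s = "if b then prune k d F I (accept F I u s) else discard u s"
    have u': "u \<in> P" using u B(1) by (auto simp: is_bucket_def)
    have sub: "pool ?s \<subseteq> P - {u}" unfolding s by auto
    have fP: "finite P" using Suc.prems(1) s by simp
    have "card (pool ?s) \<le> card (P - {u})" using sub fP by (intro card_mono) auto
    also have "\<dots> = card P - 1" using u' by (rule card_Diff_singleton)
    also have "\<dots> \<le> n" using Suc.prems(2) s by simp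
    finally show ?thesis using Suc.IH[OF _ _ s'] sub fP finite_subset by blast
  next
    case False
    then have "s' = (S, w, P, L)"
      using Suc.prems(3) unfolding s drain_Suc_no_bucket[OF False] by simp
    then show ?thesis using False by simp
  qed
qed

lemma real_dyadic_level:
  fixes x :: real
  assumes "1 \<le> x"
  obtains j where "2 ^ j \<le> x" "x < 2 ^ Suc j" "real j \<le> log 2 x"
proof -
  define j where "j = nat \<lfloor>log 2 x\<rfloor>"
  have "0 \<le> log 2 x" using assms by simp
  then have j: "real j \<le> log 2 x" "log 2 x < real (Suc j)" unfolding j_def by linarith+
  have "2 powr real j \<le> x" using j(1) assms by (simp add: le_log_iff)
  moreover have "x < 2 powr real (Suc j)" using j(2) assms by (simp only: log_less_iff)
  ultimately show ?thesis using that[of j] j(1) by (simp only: powr_realpow zero_less_numeral)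
qed

context robust_instance
begin

definition stable :: "'a set \<Rightarrow> 'a state \<Rightarrow> bool" where
  "stable E s \<longleftrightarrow> sound E s \<and> pruned s \<and> drained d f s"

lemma drain_sound:
  assumes E: "E \<subseteq> V" and s': "s' \<in> set_pmf (drain k d f indep n s)" and s: "sound E s" "pruned s"
  shows "sound E s' \<and> pruned s'"
proof -
  have "sound E s \<and> pruned s" using s by simp
  with s' show ?thesis
  proof (induction rule: drain_induct)
    case (accept u S w P L B)
    then have "u \<in> P" by (auto simp: is_bucket_def)
    moreover have "S \<inter> P = {}" using accept by simp
    ultimately have "u \<in> held (S, w, P, L)" "u \<notin> fst (S, w, P, L)" by auto
    then have "sound E (accept f indep u (S, w, P, L))"
      using sound_accept[OF E] accept(1) by blast
    then show ?case using sound_prune pruned_prune by blast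
  next
    case (discard u S w P L B)
    then show ?case using sound_discard pruned_discard by blast
  qed
qed

lemma stable_state_step:
  assumes E: "insert e E \<subseteq> V" "e \<notin> E" and s: "stable E s"
    and s': "s' \<in> set_pmf (state_step k d f indep e s)"
  shows "stable (insert e E) s'"
proof -
  obtain S w P L where s_eq: "s = (S, w, P, L)" by (cases s)
  have s'': "s' \<in> set_pmf (drain k d f indep (card (insert e P)) (arrive k d f indep e s))"
    using s' unfolding s_eq state_step.simps .
  have "sound E s" using s by (simp add: stable_def)
  have fP: "finite (insert e P)"
    using \<open>sound E s\<close> s_eq E finite_V by (auto intro: finite_subset)
  have sub: "pool (arrive k d f indep e s) \<subseteq> insert e P" by (auto simp: s_eq)
  have "drained d f s'"
    by (rule drained_drain[OF finite_subset[OF sub fP] card_mono[OF fP sub] s''])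
  moreover have "pruned (arrive k d f indep e s)" unfolding s_eq arrive.simps by (rule pruned_prune)
  then have "sound (insert e E) s' \<and> pruned s'"
    by (rule drain_sound[OF E(1) s'' sound_arrive[OF \<open>sound E s\<close> E(2)]])
  ultimately show ?thesis by (simp add: stable_def)
qed

lemma stable_run:
  "distinct es \<Longrightarrow> set es \<inter> E = {} \<Longrightarrow> set es \<union> E \<subseteq> V \<Longrightarrow> stable E s \<Longrightarrow>
    s' \<in> set_pmf (run k d f \<M> es s) \<Longrightarrow> stable (set es \<union> E) s'"
proof (induction es arbitrary: E s)
  case Nil
  then show ?case by simp
next
  case (Cons e es)
  from Cons.prems(5) obtain s1 where s1: "s1 \<in> set_pmf (state_step k d f indep e s)"
    "s' \<in> set_pmf (run k d f \<M> es s1)"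
    unfolding run.simps set_bind_pmf by blast
  have e: "insert e E \<subseteq> V" "e \<notin> E" using Cons.prems by auto
  have "stable (set es \<union> insert e E) s'"
    by (rule Cons.IH[OF _ _ _ stable_state_step[OF e Cons.prems(4) s1(1)] s1(2)])
      (use Cons.prems in auto)
  then show ?case by simp
qed

lemma stable_initial: "stable {} initial_state"
  using matroid f_empty by (auto simp: stable_def initial_state_def matroid_def is_bucket_def)

text \<open>Compare with a pool element \<open>v\<close> of least value. As \<open>v\<close> is not
  rejected, at most \<open>d\<close> pool elements reach \<open>100 * k\<close> times its value. The
  others fall into \<open>J + 1\<close> dyadic levels, each with at most \<open>100 * d\<close>
  elements since it is not a bucket.\<close>

lemma pool_bound:
  assumes E: "E \<subseteq> V" and s: "stable E (S, w, P, L)"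
  shows "real (card P) \<le> real d * (101 + 100 * log 2 (100 * real k))" "P \<noteq> {} \<Longrightarrow> 0 < k"
proof -
  let ?a = "marg f S"
  have nr: "\<not> rejected k d f indep S w L u" if "u \<in> P" for u using s that by (simp add: stable_def)
  have sets: "S \<subseteq> E" "P \<subseteq> E" "S \<inter> P = {}" using s by (auto simp: stable_def)
  have fP: "finite P" using sets(2) E finite_V by (meson finite_subset)
  have nonloop: "{u} \<in> \<M>" if "u \<in> P" for u
    by (rule matroid_subset[OF matroid not_rejectedD(2)[OF nr[OF that]]]) simp
  show k: "0 < k" if "P \<noteq> {}" using that nonloop card_indep by fastforce
  show "real (card P) \<le> real d * (101 + 100 * log 2 (100 * real k))"
  proof (cases "P = {}")
    case True
    \<comment> \<open>For \<open>k = 0\<close> this rests on \<open>ln 0 = 0\<close>.\<close>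
    have "0 \<le> log 2 (100 * real k)"
      by (cases "k = 0") (auto simp: log_def intro!: divide_nonneg_nonneg ln_ge_zero)
    then show ?thesis using True by simp
  next
    case False
    have "Min (?a ` P) \<in> ?a ` P" using False fP by (intro Min_in) auto
    then obtain v where v: "v \<in> P" "?a v = Min (?a ` P)" by (metis imageE)
    have min: "?a v \<le> ?a u" if "u \<in> P" for u unfolding v(2) using that fP by (intro Min_le) auto
    have pos: "0 < ?a v" by (rule not_rejectedD(1)[OF nr[OF v(1)]])
    obtain xs where xs: "distinct xs" "set xs = {x \<in> E. {x} \<in> \<M>}" "L = map (\<lambda>x. f {x}) xs"
      using s by (auto simp: stable_def)
    let ?q = "\<lambda>x. 100 * real k * ?a v \<le> f {x}"
    let ?H = "{u \<in> P. 100 * real k * ?a v \<le> ?a u}"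
    have H: "card ?H \<le> d"
    proof -
      \<comment> \<open>Marginal values are at most singleton values, so every pool element of high
        value has a high entry in \<open>L\<close>.\<close>
      have "?a u \<le> f {u}" if "u \<in> P" for u
      proof -
        have "?a u \<le> marg f {} u"
          using that sets E by (intro marg_antimono[OF submodular]) auto
        then show ?thesis by (simp add: marg_def f_empty)
      qed
      then have "?H \<subseteq> set (filter ?q xs)"
        using xs(2) sets(2) nonloop by fastforce
      then have "card ?H \<le> card (set (filter ?q xs))" by (intro card_mono) auto
      also have "\<dots> = length (filter ?q xs)" using xs(1) by (intro distinct_card distinct_filter)
      also have "\<dots> = length (filter (\<lambda>v'. 100 * real k * ?a v \<le> v') L)"
        by (simp add: xs(3) filter_map o_def)
      also have "\<dots> \<le> d" by (rule not_rejectedD(3)[OF nr[OF v(1)]])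
      finally show ?thesis .
    qed
    have "1 \<le> 100 * real k" using k[OF False] by simp
    then obtain J where J: "100 * real k < 2 ^ Suc J" "real J \<le> log 2 (100 * real k)"
      by (rule real_dyadic_level)
    let ?B = "\<lambda>j::nat. {u \<in> P. 2 ^ j * ?a v \<le> ?a u \<and> ?a u < 2 ^ Suc j * ?a v}"
    have level: "card (?B j) \<le> 100 * d" for j
    proof -
      have "\<not> is_bucket d f S P (?B j)" using s by (simp add: stable_def)
      moreover have "?a x \<le> 2 * ?a y" if "x \<in> ?B j" "y \<in> ?B j" for x y
        using that by auto
      ultimately show ?thesis unfolding is_bucket_def by (auto simp: not_less)
    qed
    have cover: "P - ?H \<subseteq> (\<Union>j\<in>{..J}. ?B j)"
    proof
      fix u assume u: "u \<in> P - ?H"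
      then have "1 \<le> ?a u / ?a v" using pos min[of u] by simp
      then obtain j where j: "2 ^ j \<le> ?a u / ?a v" "?a u / ?a v < 2 ^ Suc j"
        by (rule real_dyadic_level)
      have "2 ^ j * ?a v \<le> ?a u" "?a u < 2 ^ Suc j * ?a v"
        using j pos by (simp_all only: pos_le_divide_eq pos_divide_less_eq)
      moreover have "j \<le> J"
      proof -
        have "?a u < 100 * real k * ?a v" using u by auto
        then have "2 ^ j * ?a v < 2 ^ Suc J * ?a v"
          using J(1) pos \<open>2 ^ j * ?a v \<le> ?a u\<close> by (smt (verit) mult_right_mono)
        then have "(2::real) ^ j < 2 ^ Suc J" using pos by simp
        then have "j < Suc J" by (rule power_less_imp_less_exp[rotated]) simp
        then show ?thesis by simp
      qed
      ultimately show "u \<in> (\<Union>j\<in>{..J}. ?B j)" using u by auto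
    qed
    have "card (P - ?H) \<le> card (\<Union>j\<in>{..J}. ?B j)" using cover fP by (intro card_mono) auto
    also have "\<dots> \<le> (\<Sum>j\<le>J. card (?B j))" by (rule card_UN_le) simp
    also have "\<dots> \<le> (\<Sum>j\<le>J. 100 * d)" by (rule sum_mono[OF level])
    finally have low: "card (P - ?H) \<le> Suc J * (100 * d)" by simp
    have "card P \<le> card ?H + card (P - ?H)" using card_Un_le[of ?H "P - ?H"] by (simp add: Un_absorb1)
    with H low have "card P \<le> d + Suc J * (100 * d)" by linarith
    then have "real (card P) \<le> real (d + Suc J * (100 * d))" by (simp only: of_nat_le_iff)
    also have "\<dots> = real d * (101 + 100 * real J)" by (simp add: algebra_simps)
    also have "\<dots> \<le> real d * (101 + 100 * log 2 (100 * real k))"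
      using J(2) by (intro mult_left_mono) auto
    finally show ?thesis .
  qed
qed

text \<open>The constant depends on \<open>\<delta>\<close> because
  \<open>\<epsilon> < \<delta>\<close> keeps the logarithm above \<open>ln (1 / \<delta>)\<close>,
  which absorbs the additive constants of the pool bound; and \<open>d\<close> is at most
  \<open>d / \<epsilon>\<^sup>2\<close>.\<close>

lemma memory_bound:
  assumes \<delta>: "\<epsilon> < \<delta>" "\<delta> < 1" "0 < \<epsilon>"
    and E: "E \<subseteq> V" and s: "stable E s"
  shows "real (memory_size (encode s)) \<le>
    (201 + (101 + 200 * ln 100) / ln (1 / \<delta>)) * (real k + real d / \<epsilon>\<^sup>2 * ln (real k / \<epsilon>))"
proof -
  obtain S w P L where s_eq: "s = (S, w, P, L)" by (cases s)
  have S: "S \<in> \<M>" and P: "P \<subseteq> V" using s s_eq E by (auto simp: stable_def)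
  have fin: "finite S" "finite P" using matroid_finite[OF matroid S] P finite_V finite_subset by auto
  have size: "real (memory_size (encode s)) = real (card S) + real (card P)"
    using fin by (simp add: s_eq memory_size_def length_enum)
  note pb = pool_bound[OF E s[unfolded s_eq]]
  show ?thesis
  proof (cases "k = 0")
    case True
    then have "P = {}" "card S = 0" using pb(2) card_indep[OF S] by auto
    \<comment> \<open>Here \<open>ln (real k / \<epsilon>)\<close> is \<open>ln 0\<close>, which is
      0, so both sides vanish.\<close>
    then show ?thesis unfolding size using True by simp
  next
    case False
    define g where "g = ln (1 / \<delta>)"
    define l where "l = ln (real k / \<epsilon>)"
    have k1: "1 \<le> real k" using False by simp
    have g: "0 < g" unfolding g_def using \<delta> by simp
    have "1 / \<delta> \<le> real k / \<epsilon>" using \<delta> k1 by (intro frac_le) auto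
    then have gl: "g \<le> l" unfolding g_def l_def using \<delta> by (intro ln_mono) auto
    have "real k \<le> real k / \<epsilon>" using \<delta> k1 by (simp add: field_simps)
    then have kl: "ln (real k) \<le> l" unfolding l_def using k1 by (intro ln_mono) auto
    \<comment> \<open>From \<open>ln x \<le> x - 1\<close> at \<open>x = 1/2\<close>; it bounds
      \<open>log 2\<close> by twice \<open>ln\<close>.\<close>
    have ln2: "1 / 2 \<le> ln (2::real)" using ln_le_minus_one[of "1 / 2 :: real"] by (simp add: ln_div)
    have nn: "0 \<le> ln (100 * real k)" using k1 by (intro ln_ge_zero) simp
    have "log 2 (100 * real k) \<le> ln (100 * real k) / (1 / 2)"
      unfolding log_def using ln2 nn by (intro divide_left_mono) auto
    also have "\<dots> = 2 * ln 100 + 2 * ln (real k)" using k1 by (simp add: ln_mult)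
    finally have log: "log 2 (100 * real k) \<le> 2 * ln 100 + 2 * l" using kl by linarith
    let ?c = "101 + 200 * ln (100::real)"
    have c: "0 \<le> ?c" by simp
    have "101 + 100 * log 2 (100 * real k) \<le> ?c + 200 * l" using log by linarith
    also have "?c \<le> ?c / g * l"
    proof -
      have "?c * g \<le> ?c * l" using c gl by (rule mult_left_mono[rotated])
      then show ?thesis using g by (simp add: field_simps)
    qed
    finally have "101 + 100 * log 2 (100 * real k) \<le> (200 + ?c / g) * l" by (simp add: algebra_simps)
    then have "real (card P) \<le> real d * ((200 + ?c / g) * l)"
      using pb(1) by (meson mult_left_mono of_nat_0_le_iff order_trans)
    also have "\<dots> \<le> (real d / \<epsilon>\<^sup>2) * ((201 + ?c / g) * l)"
    proof (rule mult_mono)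
      have "\<epsilon>\<^sup>2 \<le> 1" using \<delta> by (intro power_le_one) auto
      then show "real d \<le> real d / \<epsilon>\<^sup>2" using \<delta> by (simp add: field_simps mult_left_le)
      show "(200 + ?c / g) * l \<le> (201 + ?c / g) * l" using g gl by (intro mult_right_mono) auto
      show "0 \<le> (200 + ?c / g) * l" using c g gl by (intro mult_nonneg_nonneg add_nonneg_nonneg divide_nonneg_pos) auto
    qed simp
    finally have P_le: "real (card P) \<le> (201 + ?c / g) * (real d / \<epsilon>\<^sup>2 * l)" by (simp only: ac_simps)
    have "real (card S) \<le> 1 * real k" using card_indep[OF S] by simp
    also have "\<dots> \<le> (201 + ?c / g) * real k"
    proof (rule mult_right_mono)
      have "0 \<le> ?c / g" using c g by (rule divide_nonneg_pos)
      then show "1 \<le> 201 + ?c / g" by linarith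
    qed simp
    finally have "real (card S) + real (card P) \<le> (201 + ?c / g) * (real k + real d / \<epsilon>\<^sup>2 * l)"
      using P_le by (simp only: distrib_left)
    then show ?thesis unfolding size g_def l_def .
  qed
qed

end

section \<open>Approximation, summary size and memory of the actual algorithm\<close>

lemma card_stored_le_memory_size: "card (stored m) \<le> memory_size m"
  unfolding stored_def memory_size_def by (metis card_image_le card_length finite_set order_trans)

lemma agree_best:
  assumes "agree X F I f \<M>" "Y \<subseteq> X"
  shows "best F I Y = best f (\<lambda>A. A \<in> \<M>) Y"
proof -
  have "is_arg_max F (\<lambda>R. R \<subseteq> Y \<and> I R) R = is_arg_max f (\<lambda>R. R \<subseteq> Y \<and> R \<in> \<M>) R" for R
    using assms unfolding agree_def is_arg_max_def by (metis subset_trans)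
  then show ?thesis by (simp add: best_def arg_max_def)
qed

lemma phase2_robust_algorithm:
  "phase2 (robust_algorithm k d) f \<M> W D = return_pmf (best f (\<lambda>A. A \<in> \<M>) (W - D))"
proof -
  have "best (value_oracle (W \<union> D) f) (indep_oracle (W \<union> D) \<M>) (W - D) = best f (\<lambda>A. A \<in> \<M>) (W - D)"
    by (rule agree_best[OF agree_oracles]) auto
  then show ?thesis by (simp add: phase2_def robust_algorithm_def)
qed

text \<open>\<open>D\<close> is fixed before the random bits, so one maximiser \<open>Q\<close>
  serves all outcomes, as \<open>robust_target\<close> requires. The expectation over both phases is
  then that of \<open>best_value\<close> over \<open>run\<close>.\<close>

lemma robust_approximation_robust_algorithm:
  assumes p: "problem_instance k V f \<M>" and es: "distinct es" "set es = V"
  shows "robust_approximation 9.435 d (robust_algorithm k d) V f \<M> es"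
  unfolding robust_approximation_def
proof (intro allI impI)
  fix D assume D: "D \<subseteq> V \<and> card D \<le> d"
  interpret robust_instance k d V f \<M> using p by unfold_locales
  let ?R = "{R \<in> \<M>. R \<subseteq> V - D}"
  have R: "finite ?R" "?R \<noteq> {}" using finite_indep_sets matroid by (auto simp: matroid_def)
  have "Max (f ` ?R) \<in> f ` ?R" using R by (intro Max_in) auto
  then obtain Q where max: "Max (f ` ?R) = f Q" and Q: "Q \<in> ?R" by (rule imageE)
  interpret robust_target k d V f \<M> D Q
  proof
    show "f R \<le> f Q" if "R \<in> \<M>" "R \<subseteq> V - D" for R
      unfolding max[symmetric] using that R(1) by (intro Max_ge) auto
  qed (use D Q in auto)
  have held: "W \<subseteq> V" if "W \<in> set_pmf (phase1 (robust_algorithm k d) f \<M> es)" for W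
  proof -
    obtain s where s: "s \<in> set_pmf (run k d f \<M> es initial_state)" "W = held s"
      using \<open>W \<in> _\<close> unfolding phase1_robust_algorithm by auto
    have "stable (set es \<union> {}) s"
      by (rule stable_run[OF es(1) _ _ stable_initial s(1)]) (use es in auto)
    then show ?thesis using s(2) es(2) by (cases s) (auto simp: stable_def)
  qed
  have "bind_pmf (phase1 (robust_algorithm k d) f \<M> es) (\<lambda>W. phase2 (robust_algorithm k d) f \<M> W D) =
      map_pmf (\<lambda>s. best f (\<lambda>A. A \<in> \<M>) (held s - D)) (run k d f \<M> es initial_state)"
    unfolding phase1_robust_algorithm phase2_robust_algorithm bind_map_pmf by (simp only: map_pmf_def)
  then have "Max (f ` ?R) \<le> 9.435 * measure_pmf.expectation
      (bind_pmf (phase1 (robust_algorithm k d) f \<M> es) (\<lambda>W. phase2 (robust_algorithm k d) f \<M> W D)) f"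
    using run_approximation[OF es] unfolding max best_value_def by simp
  moreover have "S \<subseteq> W - D \<and> S \<in> \<M>" if "W \<in> set_pmf (phase1 (robust_algorithm k d) f \<M> es)"
    "S \<in> set_pmf (phase2 (robust_algorithm k d) f \<M> W D)" for S W
    using that(2) best_optimal(1,2)[OF held[OF that(1)]] unfolding phase2_robust_algorithm by simp
  ultimately show "(\<forall>W \<in> set_pmf (phase1 (robust_algorithm k d) f \<M> es).
      \<forall>S \<in> set_pmf (phase2 (robust_algorithm k d) f \<M> W D). S \<subseteq> W - D \<and> S \<in> \<M>) \<and>
      Max (f ` ?R) \<le> 9.435 * measure_pmf.expectation
        (bind_pmf (phase1 (robust_algorithm k d) f \<M> es) (\<lambda>W. phase2 (robust_algorithm k d) f \<M> W D)) f"
    by blast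
qed

text \<open>Stability holds after every prefix of the stream relative to the elements seen, which
  bounds the memory throughout; the summary is the stored set of the last memory.\<close>

lemma size_robust_algorithm:
  fixes d :: nat
  assumes p: "problem_instance k V f \<M>" and es: "distinct es" "set es = V"
    and \<delta>: "\<epsilon> < \<delta>" "\<delta> < 1" "0 < \<epsilon>"
  defines "b \<equiv> (201 + (101 + 200 * ln 100) / ln (1 / \<delta>)) * (real k + real d / \<epsilon>\<^sup>2 * ln (real k / \<epsilon>))"
  shows "memory_at_most b (robust_algorithm k d) f \<M> es"
    and "summary_size_at_most b (robust_algorithm k d) f \<M> es"
proof -
  interpret robust_instance k d V f \<M> using p by unfold_locales
  have bound: "real (memory_size (encode s)) \<le> b"
    if "s \<in> set_pmf (run k d f \<M> (take i es) initial_state)" for s i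
  proof -
    have sub: "set (take i es) \<subseteq> V" using es set_take_subset by fast
    have "stable (set (take i es) \<union> {}) s"
      by (rule stable_run[OF _ _ _ stable_initial that]) (use es sub in auto)
    then show ?thesis unfolding b_def using sub by (intro memory_bound[OF \<delta>]) auto
  qed
  then show "memory_at_most b (robust_algorithm k d) f \<M> es"
    unfolding memory_at_most_def memory_after_robust_algorithm by auto
  show "summary_size_at_most b (robust_algorithm k d) f \<M> es"
    unfolding summary_size_at_most_def phase1_robust_algorithm set_map_pmf
  proof (intro ballI)
    fix W assume "W \<in> held ` set_pmf (run k d f \<M> es initial_state)"
    then obtain s where s: "s \<in> set_pmf (run k d f \<M> es initial_state)" "W = held s" by blast
    have "well_formed s" by (rule run_well_formed[OF _ s(1)]) (simp add: initial_state_def)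
    then have "real (card W) \<le> real (memory_size (encode s))"
      using card_stored_le_memory_size[of "encode s"] by (simp add: s(2) stored_encode)
    also have "\<dots> \<le> b" using bound[of s "length es"] s(1) by simp
    finally show "real (card W) \<le> b" .
  qed
qed

theorem theorem3:
  fixes \<delta> :: real
  assumes "0 < \<delta>" and "\<delta> < 1"
  shows "\<exists>G C :: real. \<forall>\<epsilon> :: real. 0 < \<epsilon> \<and> \<epsilon> < \<delta> \<longrightarrow>
    (\<exists>\<A> :: nat \<Rightarrow> nat \<Rightarrow> 'a algorithm. \<forall>k d.
       streaming_algorithm (\<A> k d) \<and>
       (\<forall>V f \<M> es. problem_instance k V f \<M> \<and> distinct es \<and> set es = V \<longrightarrow>
          robust_approximation (9.435 + G * \<epsilon>) d (\<A> k d) V f \<M> es \<and>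
          summary_size_at_most (C * (real k + real d / \<epsilon>\<^sup>2 * ln (real k / \<epsilon>))) (\<A> k d) f \<M> es \<and>
          memory_at_most (C * (real k + real d / \<epsilon>\<^sup>2 * ln (real k / \<epsilon>))) (\<A> k d) f \<M> es))"
proof (rule exI[of _ 0], rule exI[of _ "201 + (101 + 200 * ln 100) / ln (1 / \<delta>)"],
    intro allI impI, rule exI[of _ robust_algorithm], intro allI impI conjI)
  fix k d
  show "streaming_algorithm (robust_algorithm k d)" by (rule streaming_robust_algorithm)
next
  fix \<epsilon> :: real and k d and V :: "'a set" and f \<M> es
  assume \<epsilon>: "0 < \<epsilon> \<and> \<epsilon> < \<delta>" and inst: "problem_instance k V f \<M> \<and> distinct es \<and> set es = V"
  then have p: "problem_instance k V f \<M>" "distinct es" "set es = V" by auto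
  show "robust_approximation (9.435 + 0 * \<epsilon>) d (robust_algorithm k d) V f \<M> es"
    using robust_approximation_robust_algorithm[OF p] by simp
  show "summary_size_at_most ((201 + (101 + 200 * ln 100) / ln (1 / \<delta>))
      * (real k + real d / \<epsilon>\<^sup>2 * ln (real k / \<epsilon>))) (robust_algorithm k d) f \<M> es"
    by (rule size_robust_algorithm(2)[OF p]) (use \<epsilon> assms in auto)
  show "memory_at_most ((201 + (101 + 200 * ln 100) / ln (1 / \<delta>))
      * (real k + real d / \<epsilon>\<^sup>2 * ln (real k / \<epsilon>))) (robust_algorithm k d) f \<M> es"
    by (rule size_robust_algorithm(1)[OF p]) (use \<epsilon> assms in auto)
qed

end
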